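(* Let $D\ge 2$ be an integer, $E_0,\ldots,E_D\in\mathbb{R}$ and $\beta\in\mathbb{R}$. For each $n\in\mathbb{N}$, the limiting probability measure $P_n=\lim_{N\to\infty}\mu_N\pi_{n,N}^{-1}$ on $S_n$ is given by $$P_n\{\tau\}=C\,k\,e^{-\beta\bar E(\tau)}\rho^{k}\sigma^{m-1},\qquad \tau\in S_n,$$ where $k$ is the number of vertices of $\tau$ of height $n$ and $m$ is the number of vertices of $\tau$ of height less than $n$.
   Context: $\mathbb{N}=\{1,2,\ldots\}$. A plane tree (ordered tree) is a rooted tree in which the child subtrees of every vertex are linearly ordered (trees are considered up to isomorphism preserving the root and these orders). The branching number $\deg(v)$ of a vertex $v$ is its number of children; the height $h(v)$ is its distance to the root; the height of a finite tree is the maximal height of its vertices. $\mathbb{T}_N$ is the set of all plane trees on $N$ vertices with all branching numbers at most $D$. For a tree $T$ with vertex set $V(T)$, $E(T)=\sum_{v\in V(T)}E_{\deg(v)}$. The probability measure $\mu_N$ on $\mathbb{T}_N$ is $\mu_N\{T\}=e^{-\beta E(T)}/Z_N$, $Z_N=\sum_{T\in\mathbb{T}_N}e^{-\beta E(T)}$. For $T\in\mathbb{T}_N$, $\pi_{n,N}T$ is the subtree spanned by all vertices of height at most $n$. $S_n$ is the finite set of plane trees of height exactly $n$ with all branching numbers at most $D$. For $N$ sufficiently large, $\pi_{n,N}$ maps $\mathbb{T}_N$ into $S_n$, and $P_n$ denotes the limit in total variation, as $N\to\infty$, of the push-forwards $\mu_N\pi_{n,N}^{-1}$ (this limit exists).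 For $\tau\in S_n$, $\bar E(\tau)=\sum_{v\in V(\tau),\,h(v)<n}E_{\deg(v)}$. Let $\Delta=\{p=(p_0,\ldots,p_D)\in[0,1]^{D+1}:\ \sum_{i=0}^D p_i=1,\ \sum_{i=0}^D i p_i=1\}$ and $J(p)=\sum_{i=0}^D p_i\ln p_i+\beta\sum_{i=0}^D p_iE_i$ for $p\in\Delta$ (with $0\ln 0=0$). $J$ is strictly convex and attains its minimum on $\Delta$ at a unique point $p^*$; it has the form $p^*_i=Ce^{-\beta E_i}\rho^i$, $i=0,\ldots,D$, where $\rho>0$ is the unique positive solution of $\sum_{i=0}^D e^{-\beta E_i}\rho^i=\sum_{i=0}^D i e^{-\beta E_i}\rho^i$ and $1/C=\sum_{i=0}^D e^{-\beta E_i}\rho^i$. Finally $\sigma=e^{J(p^* )}$. *)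

theory Defs
  imports "HOL-Probability.Probability"
begin

text \<open>Every plane tree has exactly one representative in this datatype. Vertices are addressed by
  the list of child positions on the path from the root.\<close>

datatype ptree = Node (children: "ptree list")

primrec is_vertex :: "nat list \<Rightarrow> ptree \<Rightarrow> bool" where
  "is_vertex [] t \<longleftrightarrow> True"
| "is_vertex (i # v) t \<longleftrightarrow> i < length (children t) \<and> is_vertex v (children t ! i)"

primrec subtree_at :: "nat list \<Rightarrow> ptree \<Rightarrow> ptree" where
  "subtree_at [] t = t"
| "subtree_at (i # v) t = subtree_at v (children t ! i)"

definition verts :: "ptree \<Rightarrow> nat list set" where
  "verts t = {v. is_vertex v t}"

definition deg :: "ptree \<Rightarrow> nat list \<Rightarrow> nat" where
  "deg t v = length (children (subtree_at v t))"

text \<open>The height of the vertex \<open>v\<close> is \<open>length v\<close>.\<close>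

definition height :: "ptree \<Rightarrow> nat" where
  "height t = Max (length ` verts t)"

definition plane_trees :: "nat \<Rightarrow> nat \<Rightarrow> ptree set" where
  "plane_trees D N = {t. card (verts t) = N \<and> (\<forall>v\<in>verts t. deg t v \<le> D)}"

definition plane_trees_height :: "nat \<Rightarrow> nat \<Rightarrow> ptree set" where
  "plane_trees_height D n = {t. height t = n \<and> (\<forall>v\<in>verts t. deg t v \<le> D)}"

definition energy :: "(nat \<Rightarrow> real) \<Rightarrow> ptree \<Rightarrow> real" where
  "energy E t = (\<Sum>v\<in>verts t. E (deg t v))"

definition energy_below :: "(nat \<Rightarrow> real) \<Rightarrow> nat \<Rightarrow> ptree \<Rightarrow> real" where
  "energy_below E n t = (\<Sum>v\<in>{v\<in>verts t. length v < n}. E (deg t v))"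

definition Z :: "nat \<Rightarrow> (nat \<Rightarrow> real) \<Rightarrow> real \<Rightarrow> nat \<Rightarrow> real" where
  "Z D E \<beta> N = (\<Sum>t\<in>plane_trees D N. exp (- \<beta> * energy E t))"

text \<open>Meaningful for \<open>N \<ge> 1\<close> only, see \<open>pmf_mu\<close> below.\<close>

definition mu :: "nat \<Rightarrow> (nat \<Rightarrow> real) \<Rightarrow> real \<Rightarrow> nat \<Rightarrow> ptree pmf" where
  "mu D E \<beta> N =
    embed_pmf (\<lambda>t. if t \<in> plane_trees D N then exp (- \<beta> * energy E t) / Z D E \<beta> N else 0)"

primrec trunc :: "nat \<Rightarrow> ptree \<Rightarrow> ptree" where
  "trunc 0 t = Node []"
| "trunc (Suc n) t = Node (map (trunc n) (children t))"

definition tv_dist :: "'a pmf \<Rightarrow> 'a pmf \<Rightarrow> real" where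
  "tv_dist p q = (SUP A. \<bar>measure_pmf.prob p A - measure_pmf.prob q A\<bar>)"

definition tv_limit :: "(nat \<Rightarrow> 'a pmf) \<Rightarrow> 'a pmf \<Rightarrow> bool" where
  "tv_limit X P \<longleftrightarrow> (\<lambda>N. tv_dist (X N) P) \<longlonglongrightarrow> 0"

definition P_lim :: "nat \<Rightarrow> (nat \<Rightarrow> real) \<Rightarrow> real \<Rightarrow> nat \<Rightarrow> ptree pmf" where
  "P_lim D E \<beta> n = (THE P. tv_limit (\<lambda>N. map_pmf (trunc n) (mu D E \<beta> N)) P)"

text \<open>Vectors in \<open>[0,1]\<^sup>D\<^sup>+\<^sup>1\<close> are extensional functions on \<open>{..D}\<close>, so that equality of vectors
  is equality of functions.\<close>

definition \<Delta> :: "nat \<Rightarrow> (nat \<Rightarrow> real) set" where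
  "\<Delta> D = {p \<in> {..D} \<rightarrow>\<^sub>E {0..1}. (\<Sum>i\<le>D. p i) = 1 \<and> (\<Sum>i\<le>D. real i * p i) = 1}"

text \<open>The convention \<open>0 ln 0 = 0\<close> is automatic.\<close>

definition J :: "nat \<Rightarrow> (nat \<Rightarrow> real) \<Rightarrow> real \<Rightarrow> (nat \<Rightarrow> real) \<Rightarrow> real" where
  "J D E \<beta> p = (\<Sum>i\<le>D. p i * ln (p i)) + \<beta> * (\<Sum>i\<le>D. p i * E i)"

definition p_star :: "nat \<Rightarrow> (nat \<Rightarrow> real) \<Rightarrow> real \<Rightarrow> nat \<Rightarrow> real" where
  "p_star D E \<beta> = (THE p. is_arg_min (J D E \<beta>) (\<lambda>p. p \<in> \<Delta> D) p)"

definition \<sigma> :: "nat \<Rightarrow> (nat \<Rightarrow> real) \<Rightarrow> real \<Rightarrow> real" where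
  "\<sigma> D E \<beta> = exp (J D E \<beta> (p_star D E \<beta>))"

definition \<rho> :: "nat \<Rightarrow> (nat \<Rightarrow> real) \<Rightarrow> real \<Rightarrow> real" where
  "\<rho> D E \<beta> = (THE r. r > 0 \<and>
    (\<Sum>i\<le>D. exp (- \<beta> * E i) * r ^ i) = (\<Sum>i\<le>D. real i * exp (- \<beta> * E i) * r ^ i))"

definition C :: "nat \<Rightarrow> (nat \<Rightarrow> real) \<Rightarrow> real \<Rightarrow> real" where
  "C D E \<beta> = 1 / (\<Sum>i\<le>D. exp (- \<beta> * E i) * \<rho> D E \<beta> ^ i)"


text \<open>The truncation keeps exactly the vertices of height at most \<open>n\<close>, and a plane tree is
  determined by its set of vertices.\<close>

lemma verts_trunc: "verts (trunc n t) = {v \<in> verts t. length v \<le> n}"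
proof -
  have "is_vertex v (trunc n t) \<longleftrightarrow> is_vertex v t \<and> length v \<le> n" for v
  proof (induction v arbitrary: n t)
    case (Cons i v)
    then show ?case by (cases n) auto
  qed simp
  then show ?thesis by (auto simp: verts_def)
qed

lemma verts_Node:
  "verts (Node ts) = insert [] (\<Union>i<length ts. (#) i ` verts (ts ! i))"
proof -
  have "v \<in> verts (Node ts) \<longleftrightarrow> v \<in> insert [] (\<Union>i<length ts. (#) i ` verts (ts ! i))" for v
    by (cases v) (auto simp: verts_def)
  then show ?thesis by blast
qed

lemma verts_inject: "verts s = verts t \<longleftrightarrow> s = t"
proof
  assume "verts s = verts t"
  then show "s = t"
  proof (induction s arbitrary: t)
    case (Node ss)
    obtain ts where t: "t = Node ts" by (cases t)
    have iff: "is_vertex v (Node ss) \<longleftrightarrow> is_vertex v (Node ts)" for v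
      using Node.prems unfolding t verts_def by blast
    have "i < length ss \<longleftrightarrow> i < length ts" for i
      using iff[of "[i]"] by simp
    then have len: "length ss = length ts"
      by (metis linorder_neqE_nat less_irrefl)
    have "ss ! i = ts ! i" if "i < length ss" for i
    proof (rule Node.IH)
      show "ss ! i \<in> set ss" using that by simp
      show "verts (ss ! i) = verts (ts ! i)"
        using iff[of "i # v" for v] that len by (auto simp: verts_def)
    qed
    then show ?case using len t by (simp add: nth_equalityI)
  qed
qed simp

lemma finite_verts: "finite (verts t)"
  by (induction t) (simp add: verts_Node)

lemma card_verts_Node: "card (verts (Node ts)) = Suc (\<Sum>i<length ts. card (verts (ts ! i)))"
proof -
  have "card (\<Union>i<length ts. (#) i ` verts (ts ! i)) = (\<Sum>i<length ts. card ((#) i ` verts (ts ! i)))"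
    by (rule card_UN_disjoint) (auto simp: finite_verts)
  also have "\<dots> = (\<Sum>i<length ts. card (verts (ts ! i)))"
    by (intro sum.cong refl card_image) auto
  finally show ?thesis
    unfolding verts_Node by (subst card_insert_disjoint) (auto simp: finite_verts)
qed

lemma card_verts_pos: "card (verts t) \<ge> 1"
  by (cases t) (simp add: card_verts_Node)

lemma finite_plane_trees: "finite (plane_trees D N)"
proof -
  have "finite {t. card (verts t) \<le> N}"
  proof (induction N)
    case 0
    have "\<not> card (verts t) \<le> 0" for t using card_verts_pos[of t] by linarith
    then have "{t. card (verts t) \<le> 0} = {}" by blast
    then show ?case by (metis finite.emptyI)
  next
    case (Suc N)
    let ?A = "{t. card (verts t) \<le> N}"
    have "{t. card (verts t) \<le> Suc N} \<subseteq> Node ` {ts. set ts \<subseteq> ?A \<and> length ts \<le> N}"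
    proof
      fix t assume "t \<in> {t. card (verts t) \<le> Suc N}"
      moreover obtain ts where t: "t = Node ts" by (cases t)
      ultimately have le: "(\<Sum>i<length ts. card (verts (ts ! i))) \<le> N"
        by (simp add: card_verts_Node)
      have "(\<Sum>i<length ts. 1) \<le> (\<Sum>i<length ts. card (verts (ts ! i)))"
        by (intro sum_mono card_verts_pos)
      then have "length ts \<le> N" using le by simp
      moreover have "card (verts (ts ! i)) \<le> N" if "i < length ts" for i
        using member_le_sum[of i "{..<length ts}" "\<lambda>i. card (verts (ts ! i))"] that le by simp
      ultimately show "t \<in> Node ` {ts. set ts \<subseteq> ?A \<and> length ts \<le> N}"
        unfolding t by (intro imageI) (auto simp: in_set_conv_nth)
    qed
    then show ?case
      by (rule finite_subset) (intro finite_imageI finite_lists_length_le Suc)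
  qed
  then show ?thesis
    by (rule rev_finite_subset) (auto simp: plane_trees_def)
qed

lemma plane_trees_nonempty:
  assumes "D \<ge> 1" "N \<ge> 1"
  shows "plane_trees D N \<noteq> {}"
proof -
  have "\<exists>t. t \<in> plane_trees D N" using assms(2)
  proof (induction N rule: dec_induct)
    case base
    have "Node [] \<in> plane_trees D 1" by (simp add: plane_trees_def card_verts_Node verts_Node deg_def)
    then show ?case by blast
  next
    case (step N)
    then obtain t where "t \<in> plane_trees D N" by blast
    then have "Node [t] \<in> plane_trees D (Suc N)"
      using assms(1) by (auto simp: plane_trees_def card_verts_Node deg_def) (auto simp: verts_Node)
    then show ?case by blast
  qed
  then show ?thesis by blast
qed

lemma pmf_mu:
  assumes "D \<ge> 1" "N \<ge> 1"
  shows "pmf (mu D E \<beta> N) t =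
    (if t \<in> plane_trees D N then exp (- \<beta> * energy E t) / Z D E \<beta> N else 0)"
proof -
  let ?f = "\<lambda>t. if t \<in> plane_trees D N then exp (- \<beta> * energy E t) / Z D E \<beta> N else 0"
  have Z: "Z D E \<beta> N > 0"
    unfolding Z_def by (intro sum_pos finite_plane_trees plane_trees_nonempty assms) simp
  have nn: "?f t \<ge> 0" for t using Z by simp
  have "(\<integral>\<^sup>+t. ennreal (?f t) \<partial>count_space UNIV) = (\<Sum>t\<in>plane_trees D N. ennreal (?f t))"
    by (rule nn_integral_count_space'[OF finite_plane_trees]) auto
  also have "\<dots> = ennreal (\<Sum>t\<in>plane_trees D N. ?f t)"
    by (rule sum_ennreal) (rule nn)
  also have "(\<Sum>t\<in>plane_trees D N. ?f t) = 1"
    using Z by (simp add: sum_divide_distrib[symmetric]) (simp add: Z_def)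
  finally show ?thesis
    unfolding mu_def by (subst pmf_embed_pmf) (use nn in auto)
qed

end

theory Submission
  imports Defs
begin

text \<open>Let \<open>a\<^sub>N\<close> be the partition function and \<open>A = \<Sum> a\<^sub>N X\<^sup>N\<close>, so that \<open>A = X \<phi>(A)\<close> with
  \<open>\<phi>(s) = \<Sum> w\<^sub>i s\<^sup>i\<close> and \<open>w\<^sub>i = exp (- \<beta> E\<^sub>i)\<close>. The trees that truncate to \<open>\<tau>\<close> have the generating
  function \<open>exp (- \<beta> E(\<tau>)) X\<^sup>m A\<^sup>k\<close>, where \<open>E(\<tau>)\<close> is the energy below height \<open>n\<close>. The function
  \<open>s / \<phi>(s)\<close> has its unique maximum \<open>\<sigma>\<close> at \<open>\<rho>\<close>, and \<open>\<sigma>\<close> is the radius of convergence of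
  \<open>A\<close>, with \<open>A(\<sigma>) = \<rho>\<close>.

  The ratio limit \<open>a\<^sub>N / a\<^sub>N\<^sub>+\<^sub>1 \<longlonglongrightarrow> \<sigma>\<close> comes from counting unary vertices: inserting one above any of
  the \<open>N\<close> vertices of a tree (the operation \<open>X\<^sup>2 d/dX\<close>) shows that the mean number of unary vertices
  on \<open>N + 1\<close> vertices is \<open>w\<^sub>1 N a\<^sub>N / a\<^sub>N\<^sub>+\<^sub>1\<close>. By Jensen's
  inequality the mean is controlled by the partition function with \<open>w\<^sub>1\<close> replaced by
  \<open>w\<^sub>1 exp \<theta>\<close>, whose exponential growth rate is at most \<open>1/\<sigma> + w\<^sub>1 (exp \<theta> - 1)\<close>; letting
  \<open>\<theta>\<close> tend to \<open>0\<close> from both sides gives \<open>w\<^sub>1 \<sigma> N\<close> to leading order.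

  Since any one of the \<open>k\<close> trees can carry almost all vertices, the ratio limit yields
  \<open>liminf [X\<^sup>N] A\<^sup>k / a\<^sub>N \<ge> k \<rho>\<^sup>k\<^sup>-\<^sup>1\<close>, hence the claimed formula as a lower bound for the limit.
  The bounds add up to \<open>1\<close>, the mean size of generation \<open>n\<close> of a critical branching process, so
  they are attained.\<close>

section \<open>Generating functions of weighted plane trees\<close>

text \<open>Proved for an arbitrary commutative monoid, so that it yields the root recursions of
  cardinalities and of products of weights alike; \<open>P\<close> accommodates conditions on degree
  or height.\<close>

lemma (in comm_monoid_set) verts_Node_filter:
  "F g {v \<in> verts (Node ts). P v} =
    (if P [] then g [] else \<^bold>1) \<^bold>*
    F (\<lambda>i. F (\<lambda>v. g (i # v)) {v \<in> verts (ts ! i). P (i # v)}) {..<length ts}"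
proof -
  let ?g = "\<lambda>v. if P v then g v else \<^bold>1"
  let ?U = "\<Union>i<length ts. (#) i ` verts (ts ! i)"
  have "F g {v \<in> verts (Node ts). P v} = F ?g (insert [] ?U)"
    unfolding verts_Node[symmetric] by (simp add: inter_filter finite_verts)
  also have "\<dots> = ?g [] \<^bold>* F ?g ?U"
    by (rule insert) (auto simp: finite_verts)
  also have "F ?g ?U = F (\<lambda>i. F ?g ((#) i ` verts (ts ! i))) {..<length ts}"
    by (rule UNION_disjoint) (auto simp: finite_verts)
  also have "\<dots> = F (\<lambda>i. F (\<lambda>v. g (i # v)) {v \<in> verts (ts ! i). P (i # v)}) {..<length ts}"
    by (rule cong[OF refl], subst reindex) (simp_all only: inj_on_def comp_def inter_filter[OF finite_verts] list.inject, simp)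
  finally show ?thesis .
qed

lemma (in comm_monoid_set) verts_Node:
  "F g (verts (Node ts)) = g [] \<^bold>* F (\<lambda>i. F (\<lambda>v. g (i # v)) (verts (ts ! i))) {..<length ts}"
  using verts_Node_filter[of g ts "\<lambda>_. True"] by simp

lemma card_verts_Node_filter:
  "card {v \<in> verts (Node ts). P v} =
    of_bool (P []) + (\<Sum>i<length ts. card {v \<in> verts (ts ! i). P (i # v)})"
  using sum.verts_Node_filter[of "\<lambda>_. 1 :: nat" ts P] by simp

lemma deg_Nil [simp]: "deg (Node ts) [] = length ts"
  and deg_Cons [simp]: "deg (Node ts) (i # v) = deg (ts ! i) v"
  by (simp_all add: deg_def)

lemma sum_nth_list: "(\<Sum>i<length xs. f (xs ! i)) = sum_list (map f xs)"
  by (simp add: sum_list_sum_nth atLeast0LessThan)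

lemma prod_nth_list: "(\<Prod>i<length xs. f (xs ! i)) = prod_list (map f xs)"
  by (simp add: prod.list_conv_set_nth atLeast0LessThan)

section \<open>Vertex statistics and their recursions at the root\<close>

definition tsize :: "ptree \<Rightarrow> nat" where
  "tsize t = card (verts t)"

abbreviation fsize :: "ptree list \<Rightarrow> nat" where
  "fsize ts \<equiv> sum_list (map tsize ts)"

definition weight :: "(nat \<Rightarrow> real) \<Rightarrow> ptree \<Rightarrow> real" where
  "weight w t = (\<Prod>v\<in>verts t. w (deg t v))"

definition unary :: "ptree \<Rightarrow> nat" where
  "unary t = card {v \<in> verts t. deg t v = 1}"

definition weight_below :: "(nat \<Rightarrow> real) \<Rightarrow> nat \<Rightarrow> ptree \<Rightarrow> real" where
  "weight_below w n t = (\<Prod>v\<in>{v \<in> verts t. length v < n}. w (deg t v))"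

definition below :: "nat \<Rightarrow> ptree \<Rightarrow> nat" where
  "below n t = card {v \<in> verts t. length v < n}"

definition level :: "nat \<Rightarrow> ptree \<Rightarrow> nat" where
  "level n t = card {v \<in> verts t. length v = n}"

lemma tsize_Node [simp]: "tsize (Node ts) = Suc (fsize ts)"
  by (simp add: tsize_def card_verts_Node sum_nth_list[of "\<lambda>t. card (verts t)"] cong: map_cong)

lemma weight_Node: "weight w (Node ts) = w (length ts) * prod_list (map (weight w) ts)"
  by (simp add: weight_def prod.verts_Node prod_nth_list[of "\<lambda>t. \<Prod>v\<in>verts t. w (deg t v)"] cong: map_cong)

lemma unary_Node: "unary (Node ts) = of_bool (length ts = 1) + sum_list (map unary ts)"
  by (simp add: unary_def card_verts_Node_filter sum_nth_list[of "\<lambda>t. card {v \<in> verts t. deg t v = Suc 0}"] cong: map_cong)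

lemma weight_below_0: "weight_below w 0 t = 1"
  by (simp add: weight_below_def)

lemma weight_below_Suc:
  "weight_below w (Suc n) (Node ts) = w (length ts) * prod_list (map (weight_below w n) ts)"
  by (simp add: weight_below_def prod.verts_Node_filter
      prod_nth_list[of "\<lambda>t. \<Prod>v\<in>{v \<in> verts t. length v < n}. w (deg t v)"] cong: map_cong)

lemma below_0: "below 0 t = 0"
  by (simp add: below_def)

lemma below_Suc: "below (Suc n) (Node ts) = Suc (sum_list (map (below n) ts))"
  by (simp add: below_def card_verts_Node_filter
      sum_nth_list[of "\<lambda>t. card {v \<in> verts t. length v < n}"] cong: map_cong)

lemma level_0: "level 0 t = 1"
proof -
  have "{v \<in> verts t. length v = 0} = {[]}" by (auto simp: verts_def)
  then show ?thesis by (simp add: level_def)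
qed

lemma level_Suc: "level (Suc n) (Node ts) = sum_list (map (level n) ts)"
  by (simp add: level_def card_verts_Node_filter
      sum_nth_list[of "\<lambda>t. card {v \<in> verts t. length v = n}"] cong: map_cong)

text \<open>A degree never exceeds the number of vertices, so bounding the size bounds the degrees.
  Finiteness matters because a sum over an infinite set is 0 by default.\<close>

lemma finite_tsize: "finite {t. tsize t = N}"
proof (rule finite_subset[OF _ finite_plane_trees[of N N]])
  have "deg t v \<le> tsize t" if "v \<in> verts t" for t v
    using that
  proof (induction t arbitrary: v)
    case (Node ts)
    show ?case
    proof (cases v)
      case Nil
      have "(\<Sum>i<length ts. 1) \<le> (\<Sum>i<length ts. card (verts (ts ! i)))"
        by (intro sum_mono card_verts_pos)
      then show ?thesis unfolding Nil by (simp add: tsize_def card_verts_Node)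
    next
      case (Cons i u)
      then have i: "i < length ts" "u \<in> verts (ts ! i)" using Node.prems by (auto simp: verts_def)
      have "deg (ts ! i) u \<le> tsize (ts ! i)" using i by (intro Node.IH) auto
      also have "\<dots> \<le> fsize ts" using i by (intro member_le_sum_list) auto
      finally show ?thesis by (simp add: Cons)
    qed
  qed
  then show "{t. tsize t = N} \<subseteq> plane_trees N N"
    by (auto simp: plane_trees_def tsize_def)
qed

text \<open>A common root turns a forest of total size \<open>N\<close> into a tree of size
  \<open>N + 1\<close>.\<close>

lemma finite_fsize: "finite {ts. fsize ts = N}"
proof -
  have "Node ` {ts. fsize ts = N} \<subseteq> {t. tsize t = Suc N}" by auto
  then have "finite (Node ` {ts. fsize ts = N})" using finite_tsize finite_subset by blast
  then show ?thesis by (rule finite_imageD) (auto simp: inj_on_def)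
qed

text \<open>No degree bound is imposed on \<open>S\<close>; weights that vanish beyond degree
  \<open>D\<close> take its place.\<close>

definition tgf :: "(ptree \<Rightarrow> real) \<Rightarrow> ptree set \<Rightarrow> real fps" where
  "tgf f S = Abs_fps (\<lambda>N. \<Sum>t\<in>{t \<in> S. tsize t = N}. f t)"

definition fgf :: "(ptree list \<Rightarrow> real) \<Rightarrow> ptree list set \<Rightarrow> real fps" where
  "fgf f S = Abs_fps (\<lambda>N. \<Sum>ts\<in>{ts \<in> S. fsize ts = N}. f ts)"

lemma fgf_add: "fgf (\<lambda>ts. f ts + g ts) S = fgf f S + fgf g S"
  by (rule fps_ext) (simp add: fgf_def sum.distrib)

lemma fgf_cmult: "fgf (\<lambda>ts. c * f ts) S = fps_const c * fgf f S"
  by (rule fps_ext) (simp add: fgf_def sum_distrib_left)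

lemma fgf_cong: "(\<And>ts. ts \<in> S \<Longrightarrow> f ts = g ts) \<Longrightarrow> fgf f S = fgf g S"
  unfolding fgf_def by (intro arg_cong[where f=Abs_fps] ext sum.cong) auto

lemma tgf_Node: "tgf f (Node ` S) = fps_X * fgf (\<lambda>ts. f (Node ts)) S"
proof (rule fps_ext)
  fix N
  show "fps_nth (tgf f (Node ` S)) N = fps_nth (fps_X * fgf (\<lambda>ts. f (Node ts)) S) N"
  proof (cases N)
    case 0
    have "{t \<in> Node ` S. tsize t = 0} = {}" by auto
    then show ?thesis by (simp only: tgf_def 0 fps_nth_Abs_fps sum.empty) simp
  next
    case (Suc M)
    have "{t \<in> Node ` S. tsize t = Suc M} = Node ` {ts \<in> S. fsize ts = M}" by auto
    then show ?thesis
      unfolding tgf_def fgf_def Suc by (simp add: sum.reindex inj_on_def)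
  qed
qed

text \<open>Sizes add when a tree is put in front of a forest, so this is the Cauchy
  product.\<close>

lemma fgf_set_Cons:
  assumes "\<And>t ts. h (t # ts) = f t * g ts"
  shows "fgf h (set_Cons S L) = tgf f S * fgf g L"
proof (rule fps_ext)
  fix N
  let ?S = "\<lambda>i. {t \<in> S. tsize t = i}" and ?L = "\<lambda>i. {ts \<in> L. fsize ts = i}"
  have fin: "finite (?S i)" "finite (?L i)" for i
    using finite_tsize[of i] finite_fsize[of i] by simp_all
  have "fps_nth (tgf f S * fgf g L) N = (\<Sum>i\<in>{0..N}. (\<Sum>t\<in>?S i. f t) * (\<Sum>ts\<in>?L (N - i). g ts))"
    by (simp add: tgf_def fgf_def fps_mult_nth)
  also have "\<dots> = (\<Sum>i\<in>{0..N}. \<Sum>x\<in>?S i \<times> ?L (N - i). f (fst x) * g (snd x))"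
    by (intro sum.cong refl) (simp add: sum_product sum.cartesian_product case_prod_beta)
  also have "\<dots> = (\<Sum>x\<in>(\<Union>i\<in>{0..N}. ?S i \<times> ?L (N - i)). f (fst x) * g (snd x))"
    by (rule sum.UNION_disjoint[symmetric]) (use fin in auto)
  also have "\<dots> = (\<Sum>ts\<in>{ts \<in> set_Cons S L. fsize ts = N}. h ts)"
    by (rule sum.reindex_bij_witness[of _ "\<lambda>ts. (hd ts, tl ts)" "\<lambda>(t, ts). t # ts"])
      (auto simp: set_Cons_def assms)
  finally show "fps_nth (fgf h (set_Cons S L)) N = fps_nth (tgf f S * fgf g L) N"
    by (simp add: fgf_def)
qed

lemma fgf_listset:
  "fgf (\<lambda>ts. prod_list (map f ts)) (listset Ss) = prod_list (map (tgf f) Ss)"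
proof (induction Ss)
  case Nil
  have "{ts. ts = [] \<and> fsize ts = N} = (if N = 0 then {[]} else {})" for N by auto
  then show ?case by (intro fps_ext) (simp add: fgf_def)
next
  case (Cons S Ss)
  show ?case
    by (simp add: fgf_set_Cons[where f=f and g="\<lambda>ts. prod_list (map f ts)"] Cons.IH)
qed

lemma set_Cons_length: "{ts. length ts = Suc d} = set_Cons UNIV {ts. length ts = d}"
  by (auto simp: set_Cons_def length_Suc_conv)

lemma fgf_length:
  "fgf (\<lambda>ts. prod_list (map f ts)) {ts. length ts = d} = tgf f UNIV ^ d"
proof (induction d)
  case 0
  show ?case using fgf_listset[of f "[]"] by simp
next
  case (Suc d)
  show ?case
    unfolding set_Cons_length
    by (simp add: fgf_set_Cons[where f=f and g="\<lambda>ts. prod_list (map f ts)"] Suc.IH)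
qed

text \<open>A product rule: the additive statistic marks one of the \<open>d\<close> trees, and the
  other \<open>d - 1\<close> contribute the plain series.\<close>

lemma fgf_length_sum:
  fixes g :: "ptree \<Rightarrow> nat"
  shows "fgf (\<lambda>ts. real (sum_list (map g ts)) * prod_list (map f ts)) {ts. length ts = d} =
    of_nat d * tgf f UNIV ^ (d - 1) * tgf (\<lambda>t. real (g t) * f t) UNIV"
proof (induction d)
  case 0
  have "(\<Sum>ts | ts = [] \<and> fsize ts = N. real (sum_list (map g ts)) * prod_list (map f ts)) = 0" for N
    by (intro sum.neutral) auto
  then show ?case by (intro fps_ext) (simp add: fgf_def)
next
  case (Suc d)
  let ?p = "\<lambda>ts. prod_list (map f ts)" and ?s = "\<lambda>ts. real (sum_list (map g ts))"
  let ?A = "tgf f UNIV" and ?U = "tgf (\<lambda>t. real (g t) * f t) UNIV"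
  \<comment> \<open>\<open>hd\<close> and \<open>tl\<close> make each summand a function of the
    first tree times a function of the rest, the form that \<open>fgf_set_Cons\<close>
    requires.\<close>
  have "fgf (\<lambda>ts. ?s ts * ?p ts) {ts. length ts = Suc d} =
    fgf (\<lambda>ts. (real (g (hd ts)) * f (hd ts)) * ?p (tl ts) + f (hd ts) * (?s (tl ts) * ?p (tl ts)))
      {ts. length ts = Suc d}"
    by (rule fgf_cong) (auto simp: length_Suc_conv algebra_simps)
  also have "\<dots> = ?U * ?A ^ d + ?A * (of_nat d * ?A ^ (d - 1) * ?U)"
  proof -
    have "fgf (\<lambda>ts. (real (g (hd ts)) * f (hd ts)) * ?p (tl ts)) {ts. length ts = Suc d} = ?U * ?A ^ d"
      unfolding set_Cons_length fgf_length[symmetric] by (rule fgf_set_Cons) simp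
    moreover have "fgf (\<lambda>ts. f (hd ts) * (?s (tl ts) * ?p (tl ts))) {ts. length ts = Suc d} =
        ?A * (of_nat d * ?A ^ (d - 1) * ?U)"
      unfolding set_Cons_length Suc.IH[symmetric] by (rule fgf_set_Cons) simp
    ultimately show ?thesis by (simp only: fgf_add)
  qed
  also have "\<dots> = of_nat (Suc d) * ?A ^ (Suc d - 1) * ?U"
    by (cases d) (simp_all add: algebra_simps)
  finally show ?case .
qed

lemma tgf_by_degree:
  assumes "\<And>ts. length ts > D \<Longrightarrow> f (Node ts) = 0"
  shows "tgf f UNIV = fps_X * (\<Sum>d\<le>D. fgf (\<lambda>ts. f (Node ts)) {ts. length ts = d})"
proof -
  have "tgf f UNIV = (\<Sum>d\<le>D. tgf f (Node ` {ts. length ts = d}))"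
  proof (rule fps_ext)
    fix N
    let ?B = "\<lambda>d. {t \<in> Node ` {ts. length ts = d}. tsize t = N}"
    have fin: "finite (?B d)" for d using finite_tsize[of N] by simp
    have "fps_nth (\<Sum>d\<le>D. tgf f (Node ` {ts. length ts = d})) N = (\<Sum>d\<le>D. \<Sum>t\<in>?B d. f t)"
      by (simp add: fps_sum_nth tgf_def)
    also have "\<dots> = (\<Sum>t\<in>(\<Union>d\<le>D. ?B d). f t)"
      by (rule sum.UNION_disjoint[symmetric]) (use fin in auto)
    also have "\<dots> = (\<Sum>t | tsize t = N. f t)"
    proof (rule sum.mono_neutral_left[OF finite_tsize])
      show "\<forall>t\<in>{t. tsize t = N} - (\<Union>d\<le>D. ?B d). f t = 0"
      proof
        fix t assume t: "t \<in> {t. tsize t = N} - (\<Union>d\<le>D. ?B d)"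
        obtain ts where ts: "t = Node ts" by (cases t)
        with t have "length ts > D" by (force simp: not_le[symmetric])
        then show "f t = 0" using assms ts by simp
      qed
    qed auto
    finally show "fps_nth (tgf f UNIV) N = fps_nth (\<Sum>d\<le>D. tgf f (Node ` {ts. length ts = d})) N"
      by (simp add: tgf_def)
  qed
  then show ?thesis by (simp add: tgf_Node sum_distrib_left)
qed

lemma tgf_weight_eq:
  assumes "\<And>d. d > D \<Longrightarrow> w d = 0"
  shows "tgf (weight w) UNIV =
    fps_X * (\<Sum>d\<le>D. fps_const (w d) * tgf (weight w) UNIV ^ d)"
proof -
  have "fgf (\<lambda>ts. weight w (Node ts)) {ts. length ts = d} = fps_const (w d) * tgf (weight w) UNIV ^ d" for d
    unfolding fgf_length[symmetric] fgf_cmult[symmetric] by (rule fgf_cong) (simp add: weight_Node)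
  moreover have "weight w (Node ts) = 0" if "length ts > D" for ts
    using assms that by (simp add: weight_Node)
  ultimately show ?thesis
    by (subst tgf_by_degree[of D]) (simp_all only:)
qed

lemma affine_fixpoint:
  fixes u :: "'a :: comm_ring_1"
  assumes "u = b + g * u"
  shows "u * (1 - g) = b"
proof -
  have "u * (1 - g) = u - g * u" by (simp add: algebra_simps)
  then show ?thesis using assms by (metis add_diff_cancel_right')
qed

text \<open>Counting unary vertices and differentiating both linearise A = X \<phi>(A). With G =
  \<phi>'(A) they give U (1 - X G) = w1 X A and X A' (1 - X G) = A, and the common factor
  cancels.\<close>

lemma tgf_unary:
  assumes w: "\<And>d. d > D \<Longrightarrow> w d = 0" and D: "D \<ge> 1"
  shows "tgf (\<lambda>t. real (unary t) * weight w t) UNIV =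
    fps_const (w 1) * fps_X ^ 2 * fps_deriv (tgf (weight w) UNIV)" (is "?U = _")
proof -
  let ?A = "tgf (weight w) UNIV"
  define G where "G = (\<Sum>d\<le>D. fps_const (w d) * (of_nat d * ?A ^ (d - 1)))"
  have "fgf (\<lambda>ts. real (unary (Node ts)) * weight w (Node ts)) {ts. length ts = d} =
     of_bool (d = 1) * (fps_const (w 1) * ?A) + fps_const (w d) * (of_nat d * ?A ^ (d - 1)) * ?U" for d
  proof -
    have "fgf (\<lambda>ts. real (unary (Node ts)) * weight w (Node ts)) {ts. length ts = d} =
      fgf (\<lambda>ts. (of_bool (d = 1) * w d) * prod_list (map (weight w) ts) +
        w d * (real (sum_list (map unary ts)) * prod_list (map (weight w) ts))) {ts. length ts = d}"
      by (rule fgf_cong) (simp add: weight_Node unary_Node algebra_simps)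
    also have "\<dots> = fps_const (of_bool (d = 1) * w d) * ?A ^ d
        + fps_const (w d) * (of_nat d * ?A ^ (d - 1) * ?U)"
      by (simp only: fgf_add fgf_cmult fgf_length fgf_length_sum)
    finally show ?thesis by (cases "d = 1") (simp_all add: mult.assoc)
  qed
  moreover have "weight w (Node ts) = 0" if "length ts > D" for ts
    using w that by (simp add: weight_Node)
  ultimately have "?U = fps_X * (\<Sum>d\<le>D. of_bool (d = 1) * (fps_const (w 1) * ?A) +
      fps_const (w d) * (of_nat d * ?A ^ (d - 1)) * ?U)"
    by (subst tgf_by_degree[of D]) (simp_all only: mult_zero_right)
  also have "\<dots> = fps_X * ((\<Sum>d\<le>D. of_bool (d = 1) * (fps_const (w 1) * ?A)) + G * ?U)"
    by (simp only: sum.distrib G_def sum_distrib_right)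
  also have "(\<Sum>d\<le>D. of_bool (d = 1) * (fps_const (w 1) * ?A)) = fps_const (w 1) * ?A"
    using D by (simp add: of_bool_def if_distrib[of "\<lambda>x. x * _"] sum.delta cong: if_cong)
  also have "fps_X * (fps_const (w 1) * ?A + G * ?U) = fps_const (w 1) * (fps_X * ?A) + fps_X * G * ?U"
    by (simp only: distrib_left mult_ac)
  finally have U: "?U * (1 - fps_X * G) = fps_const (w 1) * (fps_X * ?A)"
    by (rule affine_fixpoint)
  have "fps_deriv ?A = fps_deriv (fps_X * (\<Sum>d\<le>D. fps_const (w d) * ?A ^ d))"
    by (rule arg_cong[OF tgf_weight_eq[OF w]])
  also have "\<dots> = (\<Sum>d\<le>D. fps_const (w d) * ?A ^ d) + fps_X * G * fps_deriv ?A"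
    by (simp add: fps_deriv_sum fps_deriv_power G_def sum_distrib_left sum_distrib_right sum.distrib fps_of_nat mult_ac)
  finally have "fps_deriv ?A * (1 - fps_X * G) = (\<Sum>d\<le>D. fps_const (w d) * ?A ^ d)"
    by (rule affine_fixpoint)
  then have "fps_X * fps_deriv ?A * (1 - fps_X * G) = fps_X * (\<Sum>d\<le>D. fps_const (w d) * ?A ^ d)"
    by (simp only: mult.assoc)
  then have A: "fps_X * fps_deriv ?A * (1 - fps_X * G) = ?A"
    by (rule trans) (rule tgf_weight_eq[OF w, symmetric])
  \<comment> \<open>The constant coefficient 1 shows that the factor is nonzero and may be
    cancelled.\<close>
  have "fps_nth (1 - fps_X * G) 0 = 1" by simp
  then have nz: "1 - fps_X * G \<noteq> 0" by (metis fps_zero_nth zero_neq_one)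
  have "?U * (1 - fps_X * G) = fps_const (w 1) * (fps_X * (fps_X * fps_deriv ?A * (1 - fps_X * G)))"
    by (simp only: U A)
  also have "\<dots> = (fps_const (w 1) * fps_X ^ 2 * fps_deriv ?A) * (1 - fps_X * G)"
    by (simp only: power2_eq_square mult_ac)
  finally show ?thesis using nz by (metis mult_right_cancel)
qed

section \<open>Fibres of the truncation\<close>

lemma trunc_fibre_Suc:
  "{t. trunc (Suc n) t = Node ss} = Node ` listset (map (\<lambda>s. {t. trunc n t = s}) ss)"
proof -
  have "map (trunc n) ts = ss \<longleftrightarrow> ts \<in> listset (map (\<lambda>s. {t. trunc n t = s}) ss)" for ts
    by (induction ss arbitrary: ts) (auto simp: set_Cons_def)
  then have "trunc (Suc n) (Node ts) = Node ss \<longleftrightarrow> Node ts \<in> Node ` listset (map (\<lambda>s. {t. trunc n t = s}) ss)" for ts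
    by auto
  then have "trunc (Suc n) t = Node ss \<longleftrightarrow> t \<in> Node ` listset (map (\<lambda>s. {t. trunc n t = s}) ss)" for t
    by (cases t) blast
  then show ?thesis by blast
qed

lemma prod_list_fps:
  "prod_list (map (\<lambda>s. fps_const (f s) * fps_X ^ g s * (A :: real fps) ^ h s) ss) =
    fps_const (prod_list (map f ss)) * fps_X ^ sum_list (map g ss) * A ^ sum_list (map h ss)"
proof (induction ss)
  case (Cons s ss)
  show ?case
    by (simp only: list.map prod_list.Cons sum_list.Cons Cons.IH) (simp only: power_add fps_const_mult[symmetric] mult_ac)
qed simp

text \<open>A vertex of \<open>s\<close> below height \<open>n\<close> keeps its degree in every
  tree of the fibre and contributes its weight and one X, whereas at each vertex of height
  \<open>n\<close> an arbitrary tree may be attached, contributing A.\<close>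

lemma tgf_trunc_fibre:
  assumes "\<forall>v\<in>verts s. length v \<le> n"
  shows "tgf (weight w) {t. trunc n t = s} =
    fps_const (weight_below w n s) * fps_X ^ below n s * tgf (weight w) UNIV ^ level n s"
  using assms
proof (induction n arbitrary: s)
  case 0
  have "verts s = verts (Node [])"
    using 0 by (auto simp: verts_Node) (simp add: verts_def)
  then have "s = Node []" by (simp only: verts_inject)
  then show ?case by (simp add: weight_below_0 below_0 level_0)
next
  case (Suc n)
  obtain ss where s: "s = Node ss" by (cases s)
  have IH: "tgf (weight w) {t. trunc n t = s'} =
    fps_const (weight_below w n s') * fps_X ^ below n s' * tgf (weight w) UNIV ^ level n s'"
    if "s' \<in> set ss" for s'
  proof (rule Suc.IH)
    obtain i where i: "i < length ss" "ss ! i = s'" using \<open>s' \<in> set ss\<close> by (auto simp: in_set_conv_nth)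
    have "i # v \<in> verts s" if "v \<in> verts s'" for v
      using that i by (simp add: s verts_def)
    then show "\<forall>v\<in>verts s'. length v \<le> n" using Suc.prems by fastforce
  qed
  let ?L = "listset (map (\<lambda>s. {t. trunc n t = s}) ss)"
  have len: "length ts = length ss" if "ts \<in> ?L" for ts
    using that by (induction ss arbitrary: ts) (auto simp: set_Cons_def)
  have "tgf (weight w) {t. trunc (Suc n) t = s} = fps_X * fgf (\<lambda>ts. weight w (Node ts)) ?L"
    unfolding s trunc_fibre_Suc by (rule tgf_Node)
  also have "fgf (\<lambda>ts. weight w (Node ts)) ?L = fgf (\<lambda>ts. w (length ss) * prod_list (map (weight w) ts)) ?L"
    by (rule fgf_cong) (simp add: weight_Node len)
  also have "\<dots> = fps_const (w (length ss)) * prod_list (map (tgf (weight w)) (map (\<lambda>s. {t. trunc n t = s}) ss))"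
    by (simp only: fgf_cmult fgf_listset)
  also have "map (tgf (weight w)) (map (\<lambda>s. {t. trunc n t = s}) ss) =
     map (\<lambda>s. fps_const (weight_below w n s) * fps_X ^ below n s * tgf (weight w) UNIV ^ level n s) ss"
    using IH by simp
  also have "fps_X * (fps_const (w (length ss)) * prod_list \<dots>) =
    (fps_const (w (length ss)) * fps_const (prod_list (map (weight_below w n) ss))) *
    fps_X ^ Suc (sum_list (map (below n) ss)) * tgf (weight w) UNIV ^ sum_list (map (level n) ss)"
    by (simp only: prod_list_fps) (simp only: power_Suc mult_ac)
  finally show ?case
    by (simp only: s weight_below_Suc below_Suc level_Suc fps_const_mult)
qed

section \<open>The radius of convergence\<close>

definition offspring :: "nat \<Rightarrow> (nat \<Rightarrow> real) \<Rightarrow> real \<Rightarrow> real" where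
  "offspring D w s = (\<Sum>d\<le>D. w d * s ^ d)"

text \<open>Partial sums rather than series: bounds on them need no prior knowledge of
  convergence.\<close>

definition fps_psum :: "real \<Rightarrow> real fps \<Rightarrow> nat \<Rightarrow> real" where
  "fps_psum z F M = (\<Sum>N\<le>M. fps_nth F N * z ^ N)"

lemma fps_psum_nonneg: "(\<And>N. fps_nth F N \<ge> 0) \<Longrightarrow> z \<ge> 0 \<Longrightarrow> fps_psum z F M \<ge> 0"
  by (auto simp: fps_psum_def intro!: sum_nonneg)

lemma fps_mult_nonneg:
  fixes F G :: "real fps"
  assumes "\<And>N. fps_nth F N \<ge> 0" "\<And>N. fps_nth G N \<ge> 0"
  shows "fps_nth (F * G) N \<ge> 0"
  by (auto simp: fps_mult_nth assms intro!: sum_nonneg)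

lemma fps_power_nonneg:
  fixes F :: "real fps"
  assumes "\<And>N. fps_nth F N \<ge> 0"
  shows "fps_nth (F ^ d) N \<ge> 0"
  by (induction d arbitrary: N) (auto simp: assms intro!: fps_mult_nonneg)

lemma fps_mult_nth_scaled:
  fixes F G :: "real fps"
  shows "fps_nth (F * G) N * z ^ N = (\<Sum>i\<le>N. (fps_nth F i * z ^ i) * (fps_nth G (N - i) * z ^ (N - i)))"
proof -
  have "fps_nth (F * G) N * z ^ N = (\<Sum>i\<le>N. fps_nth F i * fps_nth G (N - i) * (z ^ i * z ^ (N - i)))"
    by (simp add: fps_mult_nth atLeast0AtMost sum_distrib_right power_add[symmetric])
  then show ?thesis by (simp add: mult_ac)
qed

text \<open>The left side collects the index pairs in the triangle i + j \<le> M, which lies in the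
  square of pairs up to M.\<close>

lemma fps_psum_mult_le:
  assumes "\<And>N. fps_nth F N \<ge> 0" "\<And>N. fps_nth G N \<ge> 0" "z \<ge> 0"
  shows "fps_psum z (F * G) M \<le> fps_psum z F M * fps_psum z G M"
proof -
  let ?f = "\<lambda>i. fps_nth F i * z ^ i" and ?g = "\<lambda>i. fps_nth G i * z ^ i"
  have "fps_psum z (F * G) M = (\<Sum>k\<le>M. \<Sum>i\<le>k. ?f i * ?g (k - i))"
    by (simp add: fps_psum_def fps_mult_nth_scaled)
  also have "\<dots> = (\<Sum>(i, j)\<in>{(i, j). i + j \<le> M}. ?f i * ?g j)"
    by (rule sum.triangle_reindex_eq[symmetric])
  also have "\<dots> \<le> (\<Sum>(i, j)\<in>{..M} \<times> {..M}. ?f i * ?g j)"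
    by (intro sum_mono2) (auto simp: assms)
  also have "\<dots> = fps_psum z F M * fps_psum z G M"
    by (simp add: fps_psum_def sum_product sum.cartesian_product)
  finally show ?thesis .
qed

lemma fps_psum_power_le:
  assumes "\<And>N. fps_nth F N \<ge> 0" "z \<ge> 0"
  shows "fps_psum z (F ^ d) M \<le> fps_psum z F M ^ d"
proof (induction d)
  case 0
  have "fps_psum z 1 M = (\<Sum>N\<le>M. if N = 0 then 1 else 0)"
    unfolding fps_psum_def by (intro sum.cong) auto
  then show ?case by simp
next
  case (Suc d)
  have "fps_psum z (F ^ Suc d) M \<le> fps_psum z F M * fps_psum z (F ^ d) M"
    by (simp add: fps_psum_mult_le fps_power_nonneg assms)
  also have "\<dots> \<le> fps_psum z F M * fps_psum z F M ^ d"
    by (intro mult_left_mono Suc.IH fps_psum_nonneg assms)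
  finally show ?case by simp
qed

lemma fps_power_sums:
  fixes F :: "real fps" and z s :: real
  assumes "\<And>N. fps_nth F N \<ge> 0" "z \<ge> 0" and s: "(\<lambda>N. fps_nth F N * z ^ N) sums s"
  shows "(\<lambda>N. fps_nth (F ^ d) N * z ^ N) sums (s ^ d)"
proof (induction d)
  case 0
  have "(\<lambda>N. fps_nth (F ^ 0) N * z ^ N) = (\<lambda>N. if N = 0 then 1 else 0)" by auto
  then show ?case using sums_single[of 0 "\<lambda>_. 1 :: real"] by simp
next
  case (Suc d)
  have "(\<lambda>k. \<Sum>i\<le>k. (fps_nth F i * z ^ i) * (fps_nth (F ^ d) (k - i) * z ^ (k - i))) sums
      ((\<Sum>k. fps_nth F k * z ^ k) * (\<Sum>k. fps_nth (F ^ d) k * z ^ k))"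
    using s Suc assms fps_power_nonneg[of F]
    by (intro Cauchy_product_sums) (simp_all add: sums_iff abs_mult)
  then show ?case
    unfolding power_Suc fps_mult_nth_scaled using s Suc by (simp add: sums_iff)
qed

lemma tgf_nonneg: "(\<And>d. w d \<ge> 0) \<Longrightarrow> fps_nth (tgf (weight w) UNIV) N \<ge> 0"
  by (auto simp: tgf_def weight_def intro!: sum_nonneg prod_nonneg)

lemma tgf_0: "fps_nth (tgf f UNIV) 0 = 0"
proof -
  have "tsize t \<noteq> 0" for t using card_verts_pos[of t] by (simp add: tsize_def)
  then have "{t. tsize t = 0} = {}" by blast
  then show ?thesis by (simp only: tgf_def fps_nth_Abs_fps UNIV_I simp_thms sum.empty)
qed

lemma tgf_weight_Suc:
  assumes "\<And>d. d > D \<Longrightarrow> w d = 0"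
  shows "fps_nth (tgf (weight w) UNIV) (Suc N) = (\<Sum>d\<le>D. w d * fps_nth (tgf (weight w) UNIV ^ d) N)"
  by (subst tgf_weight_eq[OF assms]) (simp_all add: fps_sum_nth)

text \<open>With z = s / \<phi>(s), s is a fixed point of t \<mapsto> z \<phi>(t), which is
  nondecreasing on t \<ge> 0. The functional equation bounds the partial sum up to
  \<open>M + 1\<close> by the image of the one up to \<open>M\<close>, so s remains an upper
  bound.\<close>

lemma tgf_weight_le:
  assumes w: "\<And>d. w d \<ge> 0" "\<And>d. d > D \<Longrightarrow> w d = 0" and s: "s > 0" and pos: "offspring D w s > 0"
  shows "fps_psum (s / offspring D w s) (tgf (weight w) UNIV) M \<le> s"
proof (induction M)
  case 0
  show ?case using s by (simp add: fps_psum_def tgf_0)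
next
  case (Suc M)
  let ?A = "tgf (weight w) UNIV"
  define z where "z = s / offspring D w s"
  note nn = tgf_nonneg[OF w(1)]
  have z: "z > 0" using s pos by (simp add: z_def)
  have "fps_psum z ?A (Suc M) = z * (\<Sum>N\<le>M. \<Sum>d\<le>D. w d * (fps_nth (?A ^ d) N * z ^ N))"
    unfolding fps_psum_def sum.atMost_Suc_shift
    by (simp add: tgf_0 tgf_weight_Suc[of D w, OF w(2)] sum_distrib_left sum_distrib_right mult_ac)
  also have "\<dots> = z * (\<Sum>d\<le>D. w d * fps_psum z (?A ^ d) M)"
    unfolding fps_psum_def sum_distrib_left by (subst sum.swap) simp
  also have "\<dots> \<le> z * (\<Sum>d\<le>D. w d * fps_psum z ?A M ^ d)"
    using z w by (intro mult_left_mono sum_mono fps_psum_power_le nn) simp_all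
  also have "\<dots> \<le> z * (\<Sum>d\<le>D. w d * s ^ d)"
    using z w Suc[folded z_def] by (intro mult_left_mono sum_mono power_mono fps_psum_nonneg nn) simp_all
  also have "\<dots> = s" using pos by (simp add: offspring_def z_def)
  finally show ?case unfolding z_def .
qed

lemma tgf_weight_sums:
  assumes w: "\<And>d. w d \<ge> 0" "\<And>d. d > D \<Longrightarrow> w d = 0" and z: "z > 0"
    and s: "(\<lambda>N. fps_nth (tgf (weight w) UNIV) N * z ^ N) sums s"
  shows "s = z * offspring D w s"
proof -
  let ?A = "tgf (weight w) UNIV"
  have "(\<lambda>N. z * (\<Sum>d\<le>D. w d * (fps_nth (?A ^ d) N * z ^ N))) sums (z * (\<Sum>d\<le>D. w d * s ^ d))"
    using z by (intro sums_mult sums_sum fps_power_sums s tgf_nonneg w) simp_all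
  also have "(\<lambda>N. z * (\<Sum>d\<le>D. w d * (fps_nth (?A ^ d) N * z ^ N))) = (\<lambda>N. fps_nth ?A (Suc N) * z ^ Suc N)"
    by (simp add: tgf_weight_Suc[of D w, OF w(2)] sum_distrib_left sum_distrib_right mult_ac)
  finally have "(\<lambda>N. fps_nth ?A N * z ^ N) sums (z * offspring D w s)"
    by (subst (asm) sums_Suc_iff) (simp add: tgf_0 offspring_def)
  then show ?thesis using s sums_unique2 by blast
qed

section \<open>Critical weights and the maximum of s / \<phi>(s)\<close>

locale critical_weights =
  fixes D :: nat and w :: "nat \<Rightarrow> real" and r :: real
  assumes D: "D \<ge> 2" and w_pos: "i \<le> D \<Longrightarrow> w i > 0" and w_zero: "i > D \<Longrightarrow> w i = 0"
    and r_pos: "r > 0" and critical: "(\<Sum>i\<le>D. w i * r ^ i) = (\<Sum>i\<le>D. real i * w i * r ^ i)"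
begin

text \<open>\<open>critical\<close> says \<phi>(r) = r \<phi>'(r), so the derivative of s /
  \<phi>(s) vanishes at \<open>r\<close>; \<open>q\<close> is the value there and turns out to be
  \<sigma> in \<open>\<sigma>_eq\<close>.\<close>

definition q :: real where
  "q = r / offspring D w r"

definition gf :: "real fps" where
  "gf = tgf (weight w) UNIV"

abbreviation a :: "nat \<Rightarrow> real" where
  "a N \<equiv> fps_nth gf N"

lemma w_nonneg: "w i \<ge> 0"
  using w_pos[of i] w_zero[of i] by (cases "i \<le> D") auto

lemma offspring_pos: "s > 0 \<Longrightarrow> offspring D w s > 0"
  unfolding offspring_def by (intro sum_pos) (auto simp: w_pos)

lemma q_pos: "q > 0"
  by (simp add: q_def r_pos offspring_pos)

text \<open>\<open>w 1 * q\<close> is the probability of one child under the offspring law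
  \<open>w i * r ^ i / offspring D w r\<close>; it is less than 1 because having no child has
  positive probability.\<close>

lemma w1_q: "0 < w 1 * q" "w 1 * q < 1"
proof -
  show "0 < w 1 * q" using D q_pos by (simp add: w_pos)
  have "(\<Sum>d\<in>{0, 1}. w d * r ^ d) \<le> offspring D w r"
    unfolding offspring_def using D r_pos w_nonneg by (intro sum_mono2) auto
  then have "w 1 * r < offspring D w r" using w_pos[of 0] by simp
  then show "w 1 * q < 1" using offspring_pos[OF r_pos] by (simp add: q_def)
qed

text \<open>The function y^(i-1) is convex and lies above its tangent at 1, strictly for i = 0 and y
  different from 1. Writing it as \<open>y ^ i / y\<close> covers the exponent -1.\<close>

lemma power_div_ge:
  assumes y: "(y :: real) > 0"
  shows "y ^ i / y \<ge> 1 + (real i - 1) * (y - 1)"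
    and "y \<noteq> 1 \<Longrightarrow> y ^ 0 / y > 1 + (real 0 - 1) * (y - 1)"
proof -
  have "1 - y * (2 - y) = (y - 1) ^ 2" by (simp add: power2_eq_square algebra_simps)
  then have *: "1 / y - (2 - y) = (y - 1) ^ 2 / y" using y by (simp add: field_simps)
  show "y ^ i / y \<ge> 1 + (real i - 1) * (y - 1)"
  proof (cases i)
    case 0
    have "(y - 1) ^ 2 / y \<ge> 0" using y by simp
    with * show ?thesis by (simp add: 0)
  next
    case (Suc j)
    then show ?thesis using Bernoulli_inequality[of "y - 1" j] y by simp
  qed
  assume "y \<noteq> 1"
  then have "(y - 1) ^ 2 / y > 0" using y by simp
  with * show "y ^ 0 / y > 1 + (real 0 - 1) * (y - 1)" by simp
qed

text \<open>Averaging the tangent inequality for y = s / r with weights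
  \<open>w i * r ^ i / r\<close> compares \<phi>(s) / s with \<phi>(r) / r: the linear terms cancel
  by criticality, and the term i = 0 gives strictness.\<close>

lemma less_q:
  assumes s: "s > 0" "s \<noteq> r"
  shows "s / offspring D w s < q"
proof -
  define y where "y = s / r"
  have y: "y > 0" "y \<noteq> 1" using s r_pos by (auto simp: y_def)
  have "(\<Sum>i\<le>D. (real i - 1) * w i * r ^ i) = 0"
    using critical by (simp add: left_diff_distrib sum_subtractf)
  then have "offspring D w r / r =
    (\<Sum>i\<le>D. w i * r ^ i) / r + (y - 1) / r * (\<Sum>i\<le>D. (real i - 1) * w i * r ^ i)"
    by (simp add: offspring_def)
  also have "\<dots> = (\<Sum>i\<le>D. w i * r ^ i / r * (1 + (real i - 1) * (y - 1)))"
    unfolding sum_distrib_left sum_divide_distrib sum.distrib[symmetric]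
    using r_pos by (intro sum.cong refl) (simp add: field_simps)
  also have "\<dots> < (\<Sum>i\<le>D. w i * r ^ i / r * (y ^ i / y))"
  proof (rule sum_strict_mono_ex1)
    show "\<forall>i\<in>{..D}. w i * r ^ i / r * (1 + (real i - 1) * (y - 1)) \<le> w i * r ^ i / r * (y ^ i / y)"
      using power_div_ge(1)[OF y(1)] r_pos w_nonneg by (intro ballI mult_left_mono) auto
    show "\<exists>i\<in>{..D}. w i * r ^ i / r * (1 + (real i - 1) * (y - 1)) < w i * r ^ i / r * (y ^ i / y)"
      using power_div_ge(2)[OF y] r_pos w_pos[of 0]
      by (intro bexI[of _ 0] mult_strict_left_mono) simp_all
  qed simp
  also have "\<dots> = offspring D w s / s"
    using r_pos s by (simp add: y_def offspring_def sum_divide_distrib power_divide)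
  finally have "offspring D w r / r < offspring D w s / s" .
  then show ?thesis
    using offspring_pos[OF s(1)] offspring_pos[OF r_pos] s r_pos by (simp add: q_def field_simps)
qed

lemma le_q: "s > 0 \<Longrightarrow> s / offspring D w s \<le> q"
  using less_q[of s] by (cases "s = r") (auto simp: q_def)

lemma a_nonneg: "a N \<ge> 0"
  by (simp add: gf_def tgf_nonneg w_nonneg)

lemma a_Suc: "a (Suc N) = (\<Sum>d\<le>D. w d * fps_nth (gf ^ d) N)"
  unfolding gf_def by (rule tgf_weight_Suc[OF w_zero])

lemma a_Suc_ge:
  assumes "d \<le> D"
  shows "a (Suc N) \<ge> w d * fps_nth (gf ^ d) N"
  unfolding a_Suc using assms w_nonneg a_nonneg
  by (intro member_le_sum) (auto intro!: mult_nonneg_nonneg fps_power_nonneg)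

lemma a_pos: "N \<ge> 1 \<Longrightarrow> a N > 0"
proof (induction N rule: dec_induct)
  case base
  show ?case using a_Suc_ge[of 0 0] w_pos[of 0] by simp
next
  case (step N)
  have "0 < w 1 * a N" using step w_pos[of 1] D by simp
  then show ?case using a_Suc_ge[of 1 N] D by simp
qed

text \<open>Two trees can be joined under a binary root.\<close>

lemma a_supermult: "a (Suc (N + M)) \<ge> w 2 * a N * a M"
proof -
  have "a N * a ((N + M) - N) \<le> (\<Sum>i=0..N + M. a i * a (N + M - i))"
    by (rule member_le_sum[of N _ "\<lambda>i. a i * a (N + M - i)"]) (auto simp: a_nonneg)
  then have "a N * a M \<le> fps_nth (gf ^ 2) (N + M)"
    by (simp add: power2_eq_square fps_mult_nth)
  then have "w 2 * (a N * a M) \<le> w 2 * fps_nth (gf ^ 2) (N + M)"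
    by (intro mult_left_mono w_nonneg)
  also have "\<dots> \<le> a (Suc (N + M))" using D by (intro a_Suc_ge) simp
  finally show ?thesis by (simp add: mult_ac)
qed

text \<open>The functional equation at the point z. With \<open>le_q\<close> it shows that the
  series diverges beyond \<open>q\<close>.\<close>

lemma a_sums_imp:
  assumes z: "z > 0" and sm: "summable (\<lambda>N. a N * z ^ N)"
  obtains s where "s > 0" "(\<lambda>N. a N * z ^ N) sums s" "z = s / offspring D w s"
proof -
  obtain s where s: "(\<lambda>N. a N * z ^ N) sums s" using sm by blast
  have "a 1 * z ^ 1 \<le> s"
    using sum_le_suminf[OF sm, of "{1}"] s z by (simp add: a_nonneg sums_iff)
  then have "s > 0" using a_pos[of 1] z by (smt (verit) mult_pos_pos power_one_right order_refl)
  moreover have "s = z * offspring D w s"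
    using tgf_weight_sums[of w D z s] s z w_nonneg w_zero by (simp add: gf_def)
  moreover from this have "z = s / offspring D w s"
    using offspring_pos[OF \<open>s > 0\<close>] by (simp add: eq_divide_eq)
  ultimately show ?thesis using that s by blast
qed

text \<open>Convergence at \<open>q\<close> follows from \<open>tgf_weight_le\<close> with s = r;
  the sum then satisfies q = s / \<phi>(s), and the maximum is attained only at
  \<open>r\<close>.\<close>

lemma a_sums_r: "(\<lambda>N. a N * q ^ N) sums r"
proof -
  have "(\<Sum>i<n. a i * q ^ i) \<le> r" for n
  proof -
    have "(\<Sum>i<n. a i * q ^ i) \<le> (\<Sum>i\<le>n. a i * q ^ i)"
      using q_pos a_nonneg by (intro sum_mono2) auto
    also have "\<dots> \<le> r"
      using tgf_weight_le[of w D r n] w_nonneg w_zero r_pos offspring_pos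
      by (simp add: fps_psum_def gf_def q_def)
    finally show ?thesis .
  qed
  then have "summable (\<lambda>N. a N * q ^ N)"
    using q_pos a_nonneg by (intro summableI_nonneg_bounded) auto
  then obtain s where s: "s > 0" "(\<lambda>N. a N * q ^ N) sums s" "q = s / offspring D w s"
    using a_sums_imp q_pos by blast
  then have "s = r" using less_q[of s] by fastforce
  then show ?thesis using s by simp
qed

text \<open>Beyond the radius of convergence some \<open>M\<close> has
  \<open>w 2 * a M * z ^ Suc M \<ge> 1\<close>. Joining trees on \<open>M\<close> vertices under a
  binary root then shows that \<open>a N * z ^ N\<close> does not decrease from \<open>N\<close> to
  \<open>N + M + 1\<close>, so its minimum over the indices 1 to \<open>M + 1\<close> bounds
  it.\<close>

lemma a_lower_bound:
  assumes z: "z > q"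
  obtains c where "c > 0" "\<And>N. N \<ge> 1 \<Longrightarrow> a N * z ^ N \<ge> c"
proof -
  have z0: "z > 0" using z q_pos by simp
  have "\<exists>M\<ge>1. w 2 * a M * z ^ Suc M \<ge> 1"
  proof (rule ccontr)
    assume "\<not> ?thesis"
    then have small: "w 2 * a M * z ^ Suc M < 1" if "M \<ge> 1" for M using that by force
    \<comment> \<open>Strictly between \<open>q\<close> and \<open>z\<close>: if no such
      \<open>M\<close> existed, comparison with a geometric series would give convergence at
      \<open>y\<close>, although \<open>y > q\<close>.\<close>
    define y where "y = (q + z) / 2"
    have y: "q < y" "y < z" "y > 0" using z q_pos by (auto simp: y_def)
    have w2: "w 2 > 0" using D by (simp add: w_pos)
    have "summable (\<lambda>N. a N * y ^ N)"
    proof (rule summable_comparison_test')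
      show "summable (\<lambda>N. (1 / (w 2 * z)) * (y / z) ^ N)"
        using y z0 by (intro summable_mult summable_geometric) simp
      fix N :: nat assume N: "N \<ge> 1"
      have "a N * z ^ N \<le> 1 / (w 2 * z)"
        using small[OF N] w2 z0 by (simp add: field_simps)
      then have "a N * z ^ N * (y / z) ^ N \<le> 1 / (w 2 * z) * (y / z) ^ N"
        using y z0 by (intro mult_right_mono) auto
      also have "a N * z ^ N * (y / z) ^ N = a N * y ^ N"
        using z0 by (simp add: power_divide)
      finally show "norm (a N * y ^ N) \<le> (1 / (w 2 * z)) * (y / z) ^ N"
        using y a_nonneg[of N] by simp
    qed
    then obtain s where "s > 0" "y = s / offspring D w s"
      using a_sums_imp y(3) by blast
    then show False using le_q[of s] y by simp
  qed
  then obtain M where M: "M \<ge> 1" "w 2 * a M * z ^ Suc M \<ge> 1" by blast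
  define b where "b N = a N * z ^ N" for N
  have b_pos: "b N > 0" if "N \<ge> 1" for N using a_pos[OF that] z0 by (simp add: b_def)
  have b_step: "b (Suc (N + M)) \<ge> b N" for N
  proof -
    have "b N * 1 \<le> b N * (w 2 * a M * z ^ Suc M)"
      using M a_nonneg[of N] z0 by (intro mult_left_mono) (auto simp: b_def)
    also have "\<dots> = (w 2 * a N * a M) * z ^ Suc (N + M)"
      by (simp add: b_def power_add mult_ac)
    also have "\<dots> \<le> b (Suc (N + M))"
      unfolding b_def using z0 by (intro mult_right_mono a_supermult) simp
    finally show ?thesis by simp
  qed
  define c where "c = Min (b ` {1..Suc M})"
  have "c > 0" unfolding c_def using b_pos by (subst Min_gr_iff) auto
  moreover have "b N \<ge> c" if "N \<ge> 1" for N using that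
  proof (induction N rule: less_induct)
    case (less N)
    show ?case
    proof (cases "N \<le> Suc M")
      case True
      then show ?thesis unfolding c_def using less.prems by (intro Min_le) auto
    next
      case False
      then have "N = Suc ((N - Suc M) + M)" "N - Suc M \<ge> 1" "N - Suc M < N" by auto
      then show ?thesis using b_step[of "N - Suc M"] less.IH[of "N - Suc M"] by simp
    qed
  qed
  ultimately show ?thesis using that unfolding b_def by blast
qed

end

section \<open>The ratio limit\<close>

lemma weight_tilt: "weight (w(1 := x * w 1)) t = weight w t * x ^ unary t"
proof -
  have "weight (w(1 := x * w 1)) t = (\<Prod>v\<in>verts t. w (deg t v) * (if deg t v = 1 then x else 1))"
    unfolding weight_def by (intro prod.cong) auto
  also have "\<dots> = weight w t * (\<Prod>v\<in>{v \<in> verts t. deg t v = 1}. x)"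
    by (simp only: prod.distrib weight_def prod.inter_filter[OF finite_verts])
  finally show ?thesis by (simp add: unary_def)
qed

lemma ratio_shift:
  fixes b :: "nat \<Rightarrow> real"
  assumes pos: "\<And>N. N \<ge> 1 \<Longrightarrow> b N > 0" and lim: "(\<lambda>N. b N / b (Suc N)) \<longlonglongrightarrow> L"
  shows "(\<lambda>N. b (N - j) / b N) \<longlonglongrightarrow> L ^ j"
proof (induction j)
  case 0
  \<comment> \<open>\<open>b 0\<close> may be 0, so the quotient is known to be 1 only from N = 1
    on.\<close>
  have "eventually (\<lambda>N. b (N - 0) / b N = 1) sequentially"
    using eventually_ge_at_top[of 1] by eventually_elim (use pos in \<open>simp add: less_imp_neq[symmetric]\<close>)
  then show ?case by (simp add: tendsto_eventually)
next
  case (Suc j)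
  have "(\<lambda>N. b (N - Suc j) / b (Suc (N - Suc j))) \<longlonglongrightarrow> L"
    by (rule filterlim_compose[OF lim filterlim_minus_const_nat_at_top])
  then have "(\<lambda>N. b (N - Suc j) / b (Suc (N - Suc j)) * (b (N - j) / b N)) \<longlonglongrightarrow> L * L ^ j"
    by (intro tendsto_mult Suc.IH)
  moreover have "eventually (\<lambda>N. b (N - Suc j) / b (Suc (N - Suc j)) * (b (N - j) / b N) = b (N - Suc j) / b N) sequentially"
    using eventually_gt_at_top[of "Suc j"]
  proof eventually_elim
    case (elim N)
    then have "Suc (N - Suc j) = N - j" "b (N - j) > 0" using pos[of "N - j"] by auto
    then show ?case by simp
  qed
  ultimately show ?case by (simp add: tendsto_cong)
qed

text \<open>Induction on \<open>k\<close>: in the convolution of F with F^k, keep the terms where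
  one of the two indices is at most a constant J. As J grows, a small index of F yields k s^(k-1) s
  and a small index of F^k yields s^k, together (k + 1) s^k.\<close>

lemma fps_power_subexponential:
  fixes F :: "real fps" and z s :: real
  assumes nonneg: "\<And>N. fps_nth F N \<ge> 0" and pos: "\<And>N. N \<ge> 1 \<Longrightarrow> fps_nth F N > 0"
    and ratio: "(\<lambda>N. fps_nth F N / fps_nth F (Suc N)) \<longlonglongrightarrow> z" and z: "z > 0"
    and sums: "(\<lambda>N. fps_nth F N * z ^ N) sums s" and s: "s > 0"
  shows "c < real k * s ^ (k - 1) \<Longrightarrow> eventually (\<lambda>N. fps_nth (F ^ k) N \<ge> c * fps_nth F N) sequentially"
proof (induction k arbitrary: c)
  case 0
  show ?case
    using eventually_gt_at_top[of 0]
  proof eventually_elim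
    case (elim N)
    have "c * fps_nth F N \<le> 0" using 0 nonneg[of N] by (simp add: mult_nonpos_nonneg)
    then show ?case using elim by simp
  qed
next
  case (Suc k)
  let ?f = "fps_nth F" and ?g = "fps_nth (F ^ k)"
  have g: "?g N \<ge> 0" for N by (rule fps_power_nonneg[OF nonneg])
  have "real (Suc k) * s ^ k = real k * s ^ (k - 1) * s + s ^ k"
    by (cases k) (simp_all add: algebra_simps)
  \<comment> \<open>Leaves room for a \<open>c'\<close> below the bound for \<open>k\<close> that
    still satisfies \<open>c < c' * s + s ^ k\<close>.\<close>
  then have "(c - s ^ k) / s < real k * s ^ (k - 1)"
    using Suc.prems s by (simp add: pos_divide_less_eq)
  then obtain c' where c': "(c - s ^ k) / s < c'" "c' < real k * s ^ (k - 1)"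
    using dense by blast
  have "(\<lambda>N. c' * (?f N * z ^ N) + ?g N * z ^ N) sums (c' * s + s ^ k)"
    using z by (intro sums_add sums_mult sums fps_power_sums nonneg) simp
  then have "(\<lambda>J. \<Sum>j\<le>J. c' * (?f j * z ^ j) + ?g j * z ^ j) \<longlonglongrightarrow> c' * s + s ^ k"
    by (simp add: sums_def_le)
  moreover have "c < c' * s + s ^ k" using c' s by (simp add: pos_divide_less_eq)
  ultimately have "eventually (\<lambda>J. c < (\<Sum>j\<le>J. c' * (?f j * z ^ j) + ?g j * z ^ j)) sequentially"
    by (rule order_tendstoD)
  then obtain J where J: "c < (\<Sum>j\<le>J. c' * (?f j * z ^ j) + ?g j * z ^ j)"
    by (auto simp: eventually_sequentially)
  have "(\<lambda>N. \<Sum>j\<le>J. (c' * ?f j + ?g j) * (?f (N - j) / ?f N)) \<longlonglongrightarrow> (\<Sum>j\<le>J. (c' * ?f j + ?g j) * z ^ j)"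
    by (intro tendsto_sum tendsto_mult tendsto_const ratio_shift pos ratio)
  moreover have "c < (\<Sum>j\<le>J. (c' * ?f j + ?g j) * z ^ j)" using J by (simp add: algebra_simps)
  ultimately have "eventually (\<lambda>N. c < (\<Sum>j\<le>J. (c' * ?f j + ?g j) * (?f (N - j) / ?f N))) sequentially"
    by (rule order_tendstoD)
  moreover have "eventually (\<lambda>N. \<forall>j\<in>{..J}. ?g (N - j) \<ge> c' * ?f (N - j)) sequentially"
    by (intro eventually_ball_finite ballI
        eventually_compose_filterlim[OF Suc.IH[OF c'(2)] filterlim_minus_const_nat_at_top]) simp
  \<comment> \<open>For N > 2 J the two index ranges are disjoint, so no term is counted
    twice.\<close>
  ultimately show ?case
    using eventually_gt_at_top[of "2 * J"]
  proof eventually_elim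
    case (elim N)
    have fN: "?f N > 0" using elim(3) by (intro pos) simp
    have "c * ?f N \<le> (\<Sum>j\<le>J. (c' * ?f j + ?g j) * (?f (N - j) / ?f N)) * ?f N"
      using elim(1) fN by (intro mult_right_mono) auto
    also have "\<dots> = (\<Sum>j\<le>J. ?f j * (c' * ?f (N - j))) + (\<Sum>j\<le>J. ?g j * ?f (N - j))"
      unfolding sum_distrib_right sum.distrib[symmetric]
      using fN by (intro sum.cong refl) (simp add: field_simps)
    also have "\<dots> \<le> (\<Sum>j\<le>J. ?f j * ?g (N - j)) + (\<Sum>j\<le>J. ?f (N - j) * ?g j)"
      using elim(2) nonneg by (intro add_mono sum_mono mult_left_mono) (simp_all add: mult_ac)
    also have "(\<Sum>j\<le>J. ?f (N - j) * ?g j) = (\<Sum>i\<in>{N - J..N}. ?f i * ?g (N - i))"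
      by (rule sum.reindex_bij_witness[of _ "\<lambda>i. N - i" "\<lambda>j. N - j"]) (use elim(3) in auto)
    also have "(\<Sum>j\<le>J. ?f j * ?g (N - j)) + \<dots> = (\<Sum>i\<in>{..J} \<union> {N - J..N}. ?f i * ?g (N - i))"
      by (rule sum.union_disjoint[symmetric]) (use elim(3) in auto)
    also have "\<dots> \<le> (\<Sum>i=0..N. ?f i * ?g (N - i))"
      using elim(3) nonneg g by (intro sum_mono2) auto
    finally show ?case by (simp add: fps_mult_nth)
  qed
qed

section \<open>Exponential tilting by the number of unary vertices\<close>

lemma exp_le_quadratic:
  assumes "\<bar>x :: real\<bar> \<le> 1"
  shows "exp x \<le> 1 + x + x\<^sup>2"
proof (cases "x \<ge> 0")
  case True
  then show ?thesis using assms by (simp add: exp_bound)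
next
  case False
  have "exp x = 1 / exp (- x)" by (simp add: exp_minus field_simps)
  also have "\<dots> \<le> 1 / (1 - x)"
    using False exp_ge_add_one_self[of "- x"] by (intro divide_left_mono) auto
  also have "\<dots> \<le> 1 + x + x\<^sup>2"
  proof -
    \<comment> \<open>(1 + x + x^2) (1 - x) = 1 - x^3, which is at least 1 for negative
      \<open>x\<close>.\<close>
    have "x ^ 3 \<le> 0" using False by (simp add: power_le_zero_eq)
    then have "1 \<le> (1 + x + x\<^sup>2) * (1 - x)"
      by (simp add: algebra_simps power2_eq_square power3_eq_cube)
    then show ?thesis using False by (simp add: pos_divide_le_eq)
  qed
  finally show ?thesis .
qed

context critical_weights
begin

text \<open>Replacing \<open>w 1\<close> by \<open>x * w 1\<close> adds
  \<open>w 1 * (x - 1) * r\<close> to \<phi>(r). Then \<open>tgf_weight_le\<close>, applied to the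
  tilted weights at s = r, bounds each single coefficient.\<close>

lemma tilted_le:
  assumes x: "x > 0"
  shows "(\<Sum>t | tsize t = N. weight w t * x ^ unary t) \<le> r * (1 / q + w 1 * (x - 1)) ^ N"
proof -
  define v where "v = w(1 := x * w 1)"
  have v: "v d \<ge> 0" "d > D \<Longrightarrow> v d = 0" for d
    using x w_nonneg w_zero D by (auto simp: v_def)
  have "offspring D v r = (\<Sum>d\<le>D. w d * r ^ d + (if d = 1 then w 1 * (x - 1) * r else 0))"
    unfolding offspring_def v_def by (intro sum.cong) (auto simp: algebra_simps)
  also have "\<dots> = offspring D w r + w 1 * (x - 1) * r"
    using D by (simp add: sum.distrib offspring_def sum.delta)
  finally have o: "offspring D v r = offspring D w r + w 1 * (x - 1) * r" .
  have "0 < v 0 * r ^ 0" using w_pos[of 0] by (simp add: v_def)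
  also have "\<dots> \<le> offspring D v r"
    unfolding offspring_def using v r_pos by (intro member_le_sum) auto
  finally have pos: "offspring D v r > 0" .
  define z where "z = r / offspring D v r"
  have z: "z > 0" "1 / z = 1 / q + w 1 * (x - 1)"
    using pos r_pos by (simp_all add: z_def o q_def add_divide_distrib)
  have "fps_nth (tgf (weight v) UNIV) N * z ^ N \<le> fps_psum z (tgf (weight v) UNIV) N"
    unfolding fps_psum_def using z v
    by (intro member_le_sum) (auto intro!: mult_nonneg_nonneg tgf_nonneg)
  also have "\<dots> \<le> r"
    unfolding z_def by (rule tgf_weight_le) (use v r_pos pos in auto)
  finally have "fps_nth (tgf (weight v) UNIV) N \<le> r * (1 / z) ^ N"
    using z(1) by (simp add: power_one_over pos_le_divide_eq)
  then show ?thesis unfolding z(2) by (simp add: tgf_def v_def weight_tilt[simplified])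
qed

lemma unary_sum:
  "(\<Sum>t | tsize t = Suc N. real (unary t) * weight w t) = w 1 * (real N * a N)"
proof -
  have "(\<Sum>t | tsize t = Suc N. real (unary t) * weight w t) =
      fps_nth (tgf (\<lambda>t. real (unary t) * weight w t) UNIV) (Suc N)"
    by (simp add: tgf_def)
  also have "\<dots> = fps_nth (fps_const (w 1) * fps_X ^ 2 * fps_deriv gf) (Suc N)"
    unfolding gf_def using D by (subst tgf_unary[of D]) (simp_all add: w_zero)
  also have "\<dots> = w 1 * fps_nth (fps_X ^ 2 * fps_deriv gf) (Suc N)"
    by (simp only: mult.assoc fps_mult_left_const_nth)
  also have "fps_nth (fps_X ^ 2 * fps_deriv gf) (Suc N) = real N * a N"
    by (cases N) (simp_all add: fps_X_power_mult_nth)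
  finally show ?thesis .
qed

text \<open>By \<open>unary_sum\<close> this is the weighted mean number of unary vertices over
  trees on \<open>N + 1\<close>, not \<open>N\<close>, vertices.\<close>

definition mean_unary :: "nat \<Rightarrow> real" where
  "mean_unary N = w 1 * (real N * a N) / a (Suc N)"

lemma jensen_unary:
  "a (Suc N) * exp (\<theta> * mean_unary N) \<le> r * (1 / q + w 1 * (exp \<theta> - 1)) ^ Suc N"
proof -
  let ?m = "mean_unary N" and ?T = "{t. tsize t = Suc N}"
  have a: "(\<Sum>t\<in>?T. weight w t) = a (Suc N)" by (simp add: gf_def tgf_def)
  have m: "a (Suc N) * ?m = (\<Sum>t\<in>?T. real (unary t) * weight w t)"
    using a_pos[of "Suc N"] by (simp add: mean_unary_def unary_sum)
  \<comment> \<open>The added term vanishes by the choice of the mean; it turns the left side into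
    an average of a tangent line of exp, which is how Jensen's inequality arises.\<close>
  have "a (Suc N) * exp (\<theta> * ?m) =
     exp (\<theta> * ?m) * (a (Suc N) + \<theta> * ((\<Sum>t\<in>?T. real (unary t) * weight w t) - a (Suc N) * ?m))"
    unfolding m[symmetric] by simp
  also have "\<dots> = (\<Sum>t\<in>?T. weight w t * (exp (\<theta> * ?m) * (1 + \<theta> * (real (unary t) - ?m))))"
    unfolding a[symmetric] sum_distrib_right sum_subtractf[symmetric] sum_distrib_left sum.distrib[symmetric]
    by (intro sum.cong refl) (simp add: algebra_simps)
  also have "\<dots> \<le> (\<Sum>t\<in>?T. weight w t * exp \<theta> ^ unary t)"
  proof (intro sum_mono mult_left_mono)
    fix t
    have "exp (\<theta> * ?m) * (1 + \<theta> * (real (unary t) - ?m)) \<le> exp (\<theta> * ?m) * exp (\<theta> * (real (unary t) - ?m))"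
      by (intro mult_left_mono exp_ge_add_one_self) simp
    also have "\<dots> = exp \<theta> ^ unary t"
      by (simp add: exp_add[symmetric] exp_of_nat_mult[symmetric] algebra_simps)
    finally show "exp (\<theta> * ?m) * (1 + \<theta> * (real (unary t) - ?m)) \<le> exp \<theta> ^ unary t" .
    show "weight w t \<ge> 0" by (simp add: weight_def prod_nonneg w_nonneg)
  qed
  also have "\<dots> \<le> r * (1 / q + w 1 * (exp \<theta> - 1)) ^ Suc N"
    by (rule tilted_le) simp
  finally show ?thesis .
qed

text \<open>Comparing \<open>jensen_unary\<close> with \<open>a_lower_bound\<close> just beyond
  \<open>q\<close> and taking logarithms bounds \<theta> times the deviation from
  \<open>w 1 * q\<close> by a vanishing term plus a multiple of \<theta>^2. Using both signs of
  \<theta> and dividing by its absolute value bounds the deviation on both sides.\<close>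

lemma mean_unary_limit: "(\<lambda>N. mean_unary N / real (Suc N)) \<longlonglongrightarrow> w 1 * q"
proof (rule LIMSEQ_I)
  fix \<eta> :: real
  assume "\<eta> > 0"
  define p where "p = w 1 * q"
  have p: "0 < p" "p < 1" using w1_q by (simp_all add: p_def)
  \<comment> \<open>At most 1 for \<open>exp_le_quadratic\<close>; the final error is 3 \<epsilon> <
    \<eta>.\<close>
  define \<epsilon> where "\<epsilon> = min 1 (\<eta> / 4)"
  have \<epsilon>: "0 < \<epsilon>" "\<epsilon> \<le> 1" "4 * \<epsilon> \<le> \<eta>" using \<open>\<eta> > 0\<close> by (auto simp: \<epsilon>_def)
  \<comment> \<open>Leaving the radius of convergence by this factor costs \<epsilon>^2 per vertex,
    of second order against the absolute value \<epsilon> of \<theta>.\<close>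
  have "q * exp (\<epsilon>\<^sup>2) > q" using q_pos \<epsilon> by simp
  then obtain c where c: "c > 0" "\<And>N. N \<ge> 1 \<Longrightarrow> a N * (q * exp (\<epsilon>\<^sup>2)) ^ N \<ge> c"
    using a_lower_bound by blast
  have key: "\<theta> * (mean_unary N / real (Suc N) - p) \<le> ln (r / c) / real (Suc N) + 2 * \<epsilon>\<^sup>2"
    if \<theta>: "\<bar>\<theta>\<bar> = \<epsilon>" for \<theta> N
  proof -
    let ?m = "mean_unary N" and ?n = "Suc N"
    have \<theta>2: "\<theta>\<^sup>2 = \<epsilon>\<^sup>2" using \<theta> by (metis power2_abs)
    \<comment> \<open>A mixture of 1 and exp \<theta>, positive as 0 < p < 1; this permits raising
      the upper bound to a power.\<close>
    have base: "0 < q * (1 / q + w 1 * (exp \<theta> - 1))"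
    proof -
      have "q * (1 / q + w 1 * (exp \<theta> - 1)) = (1 - p) + p * exp \<theta>"
        using q_pos by (simp add: p_def algebra_simps)
      then show ?thesis using p by (simp add: add_pos_pos)
    qed
    have "q * (1 / q + w 1 * (exp \<theta> - 1)) = 1 + p * (exp \<theta> - 1)"
      using q_pos by (simp add: p_def algebra_simps)
    also have "\<dots> \<le> exp (p * (exp \<theta> - 1))" by (rule exp_ge_add_one_self)
    also have "\<dots> \<le> exp (p * \<theta> + \<epsilon>\<^sup>2)"
    proof -
      have "p * (exp \<theta> - 1) \<le> p * (\<theta> + \<epsilon>\<^sup>2)"
        using exp_le_quadratic[of \<theta>] \<theta> \<epsilon> p \<theta>2 by (intro mult_left_mono) auto
      also have "\<dots> \<le> p * \<theta> + \<epsilon>\<^sup>2"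
        using p \<epsilon> by (simp add: distrib_left mult_left_le_one_le)
      finally show ?thesis by simp
    qed
    finally have le: "q * (1 / q + w 1 * (exp \<theta> - 1)) \<le> exp (p * \<theta> + \<epsilon>\<^sup>2)" .
    have "c * exp (\<theta> * ?m) \<le> a ?n * (q * exp (\<epsilon>\<^sup>2)) ^ ?n * exp (\<theta> * ?m)"
      using c(2)[of ?n] by (intro mult_right_mono) auto
    also have "\<dots> = a ?n * exp (\<theta> * ?m) * (q * exp (\<epsilon>\<^sup>2)) ^ ?n" by simp
    also have "\<dots> \<le> r * (1 / q + w 1 * (exp \<theta> - 1)) ^ ?n * (q * exp (\<epsilon>\<^sup>2)) ^ ?n"
      using q_pos by (intro mult_right_mono jensen_unary) simp
    also have "\<dots> = r * (q * (1 / q + w 1 * (exp \<theta> - 1)) * exp (\<epsilon>\<^sup>2)) ^ ?n"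
      by (simp only: power_mult_distrib mult_ac)
    also have "\<dots> \<le> r * (exp (p * \<theta> + \<epsilon>\<^sup>2) * exp (\<epsilon>\<^sup>2)) ^ ?n"
      using r_pos base le by (intro mult_left_mono power_mono mult_right_mono) auto
    also have "exp (p * \<theta> + \<epsilon>\<^sup>2) * exp (\<epsilon>\<^sup>2) = exp (p * \<theta> + 2 * \<epsilon>\<^sup>2)"
      by (simp add: exp_add[symmetric])
    also have "exp (p * \<theta> + 2 * \<epsilon>\<^sup>2) ^ ?n = exp (real ?n * (p * \<theta> + 2 * \<epsilon>\<^sup>2))"
      by (rule exp_of_nat_mult[symmetric])
    finally have "exp (\<theta> * ?m) \<le> r / c * exp (real ?n * (p * \<theta> + 2 * \<epsilon>\<^sup>2))"
      using c(1) by (simp add: field_simps)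
    then have "ln (exp (\<theta> * ?m)) \<le> ln (r / c * exp (real ?n * (p * \<theta> + 2 * \<epsilon>\<^sup>2)))"
      by (intro ln_mono) auto
    also have "\<dots> = ln (r / c) + real ?n * (p * \<theta> + 2 * \<epsilon>\<^sup>2)"
      using c(1) r_pos by (subst ln_mult) simp_all
    finally have "\<theta> * ?m \<le> ln (r / c) + real ?n * (p * \<theta> + 2 * \<epsilon>\<^sup>2)"
      by simp
    then have "\<theta> * ?m - real ?n * (p * \<theta>) \<le> ln (r / c) + real ?n * (2 * \<epsilon>\<^sup>2)"
      by (simp add: distrib_left)
    then have "(\<theta> * ?m - real ?n * (p * \<theta>)) / real ?n \<le> (ln (r / c) + real ?n * (2 * \<epsilon>\<^sup>2)) / real ?n"
      by (rule divide_right_mono) simp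
    then show ?thesis
      by (simp only: diff_divide_distrib add_divide_distrib right_diff_distrib) (simp add: mult_ac)
  qed
  have "(\<lambda>N. ln (r / c) / real (Suc N)) \<longlonglongrightarrow> 0"
    by (rule LIMSEQ_Suc[OF lim_const_over_n])
  then have "eventually (\<lambda>N. ln (r / c) / real (Suc N) < \<epsilon>\<^sup>2) sequentially"
    using \<epsilon> by (intro order_tendstoD) auto
  then obtain M where M: "\<And>N. N \<ge> M \<Longrightarrow> ln (r / c) / real (Suc N) < \<epsilon>\<^sup>2"
    by (auto simp: eventually_sequentially)
  have "norm (mean_unary N / real (Suc N) - w 1 * q) < \<eta>" if "N \<ge> M" for N
  proof -
    have "\<bar>\<epsilon> * (mean_unary N / real (Suc N) - p)\<bar> < 3 * \<epsilon>\<^sup>2"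
      using key[of \<epsilon> N] key[of "- \<epsilon>" N] M[OF that] \<epsilon>
      by (simp only: abs_less_iff mult_minus_left) linarith
    then have "\<epsilon> * \<bar>mean_unary N / real (Suc N) - p\<bar> < \<epsilon> * (3 * \<epsilon>)"
      using \<epsilon> by (simp add: abs_mult power2_eq_square)
    then have "\<bar>mean_unary N / real (Suc N) - p\<bar> < 3 * \<epsilon>"
      using \<epsilon> by (simp only: mult_less_cancel_left_pos)
    then show ?thesis using \<epsilon> by (simp add: p_def)
  qed
  then show "\<exists>no. \<forall>N\<ge>no. norm (mean_unary N / real (Suc N) - w 1 * q) < \<eta>" by blast
qed

lemma ratio_limit: "(\<lambda>N. a N / a (Suc N)) \<longlonglongrightarrow> q"
proof -
  have "(\<lambda>N. mean_unary N / real (Suc N) / (w 1 * (real N / real (Suc N)))) \<longlonglongrightarrow> w 1 * q / (w 1 * 1)"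
    using w_pos[of 1] D LIMSEQ_n_over_Suc_n[where 'a=real]
    by (intro tendsto_divide mean_unary_limit tendsto_mult tendsto_const) auto
  moreover have "eventually (\<lambda>N. mean_unary N / real (Suc N) / (w 1 * (real N / real (Suc N))) = a N / a (Suc N)) sequentially"
    using eventually_gt_at_top[of 0]
  proof eventually_elim
    case (elim N)
    have "mean_unary N / real (Suc N) = w 1 * (real N / real (Suc N)) * (a N / a (Suc N))"
      by (simp add: mean_unary_def mult_ac)
    moreover have "w 1 * (real N / real (Suc N)) \<noteq> 0"
      using elim w_pos[of 1] D by simp
    ultimately show ?case by (metis nonzero_mult_div_cancel_left)
  qed
  ultimately show ?thesis using w_pos[of 1] D by (simp add: tendsto_cong)
qed

text \<open>With m = \<open>below n s\<close> and k = \<open>level n s\<close>, the fibre has as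
  coefficient a constant times [X^(N-m)] A^k. \<open>fps_power_subexponential\<close> compares this
  with \<open>a (N - m)\<close>, and the ratio limit turns \<open>a (N - m) / a N\<close> into
  q^m.\<close>

lemma fibre_lower:
  assumes len: "\<forall>v\<in>verts s. length v \<le> n" and deg: "\<forall>v\<in>verts s. deg s v \<le> D"
    and c: "c < weight_below w n s * q ^ below n s * (real (level n s) * r ^ (level n s - 1))"
  shows "eventually (\<lambda>N. fps_nth (tgf (weight w) {t. trunc n t = s}) N / a N \<ge> c) sequentially"
proof -
  let ?W = "weight_below w n s" and ?m = "below n s" and ?k = "level n s"
  have W: "?W > 0" unfolding weight_below_def using deg by (intro prod_pos) (auto simp: w_pos)
  define d where "d = ?W * q ^ ?m"
  have d: "d > 0" using W q_pos by (simp add: d_def)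
  have "c / d < real ?k * r ^ (?k - 1)"
    using c d by (simp add: d_def pos_divide_less_eq mult.commute)
  then obtain \<kappa> where \<kappa>: "c / d < \<kappa>" "\<kappa> < real ?k * r ^ (?k - 1)"
    using dense by blast
  have "eventually (\<lambda>N. fps_nth (gf ^ ?k) N \<ge> \<kappa> * a N) sequentially"
    by (rule fps_power_subexponential[OF a_nonneg a_pos ratio_limit q_pos a_sums_r r_pos \<kappa>(2)])
  then have "eventually (\<lambda>N. fps_nth (gf ^ ?k) (N - ?m) \<ge> \<kappa> * a (N - ?m)) sequentially"
    by (rule eventually_compose_filterlim[OF _ filterlim_minus_const_nat_at_top])
  moreover have "(\<lambda>N. ?W * \<kappa> * (a (N - ?m) / a N)) \<longlonglongrightarrow> ?W * \<kappa> * q ^ ?m"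
    by (intro tendsto_mult tendsto_const ratio_shift a_pos ratio_limit)
  then have "eventually (\<lambda>N. c < ?W * \<kappa> * (a (N - ?m) / a N)) sequentially"
    using \<kappa>(1) d by (rule_tac order_tendstoD) (simp_all add: d_def pos_divide_less_eq mult_ac)
  ultimately show ?thesis
    using eventually_gt_at_top[of ?m]
  proof eventually_elim
    case (elim N)
    have aN: "a N > 0" using elim(3) by (intro a_pos) simp
    have "c \<le> ?W * (\<kappa> * a (N - ?m)) / a N" using elim(2) by simp
    also have "\<dots> \<le> ?W * fps_nth (gf ^ ?k) (N - ?m) / a N"
      using elim(1) W aN by (intro divide_right_mono mult_left_mono) auto
    also have "?W * fps_nth (gf ^ ?k) (N - ?m) = fps_nth (tgf (weight w) {t. trunc n t = s}) N"
      unfolding tgf_trunc_fibre[OF len] using elim(3)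
      by (simp add: gf_def mult.assoc fps_X_power_mult_nth)
    finally show ?case .
  qed
qed

end

section \<open>Total mass of the limit\<close>

text \<open>Height at most \<open>n\<close>: child subtrees in a tree of height \<open>n\<close> may
  be lower than \<open>n - 1\<close>, so it is this set that satisfies a recursion in
  \<open>n\<close>. Trees without a vertex at height \<open>n\<close> drop out later, having
  \<open>level\<close> 0.\<close>

definition low_trees :: "nat \<Rightarrow> nat \<Rightarrow> ptree set" where
  "low_trees D n = {t. (\<forall>v\<in>verts t. length v \<le> n) \<and> (\<forall>v\<in>verts t. deg t v \<le> D)}"

lemma ball_verts_Node:
  "(\<forall>v\<in>verts (Node ts). P v) \<longleftrightarrow> P [] \<and> (\<forall>i<length ts. \<forall>v\<in>verts (ts ! i). P (i # v))"
  by (auto simp: verts_Node)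

lemma low_trees_0: "low_trees D 0 = {Node []}"
proof -
  have "t = Node []" if "\<forall>v\<in>verts t. length v \<le> 0" for t
  proof (cases t)
    case (Node ts)
    have "[] \<in> verts (ts ! 0)" by (simp add: verts_def)
    then show ?thesis using that unfolding Node ball_verts_Node by fastforce
  qed
  then show ?thesis by (auto simp: low_trees_def verts_Node)
qed

lemma low_trees_Suc:
  "low_trees D (Suc n) = Node ` (\<Union>d\<le>D. {ts. set ts \<subseteq> low_trees D n \<and> length ts = d})"
proof -
  have "Node ts \<in> low_trees D (Suc n) \<longleftrightarrow> length ts \<le> D \<and> set ts \<subseteq> low_trees D n" for ts
    by (auto simp: low_trees_def ball_verts_Node subset_iff in_set_conv_nth)
  then have "t \<in> low_trees D (Suc n) \<longleftrightarrow>
      t \<in> Node ` (\<Union>d\<le>D. {ts. set ts \<subseteq> low_trees D n \<and> length ts = d})" for t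
    by (cases t) auto
  then show ?thesis by blast
qed

lemma finite_low_trees: "finite (low_trees D n)"
  by (induction n) (auto simp: low_trees_0 low_trees_Suc intro!: finite_lists_length_eq)

lemma level_eq_0_iff: "level n t = 0 \<longleftrightarrow> (\<forall>v\<in>verts t. length v \<noteq> n)"
  by (auto simp: level_def finite_verts)

lemma plane_trees_height_subset: "plane_trees_height D n \<subseteq> low_trees D n"
  using finite_verts by (auto simp: plane_trees_height_def low_trees_def height_def)

lemma level_eq_0:
  assumes "t \<in> low_trees D n - plane_trees_height D n"
  shows "level n t = 0"
proof (rule ccontr)
  assume "level n t \<noteq> 0"
  then obtain v where "v \<in> verts t" "length v = n" by (auto simp: level_eq_0_iff)
  then have "height t = n"
    using assms unfolding height_def low_trees_def
    by (intro Max_eqI) (auto simp: finite_verts)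
  then show False using assms by (auto simp: plane_trees_height_def low_trees_def)
qed

lemma sum_lists_prod:
  fixes f :: "'a \<Rightarrow> 'b :: comm_semiring_1"
  assumes "finite S"
  shows "(\<Sum>xs | set xs \<subseteq> S \<and> length xs = d. prod_list (map f xs)) = (\<Sum>x\<in>S. f x) ^ d"
proof (induction d)
  case 0
  have "{xs. set xs \<subseteq> S \<and> length xs = 0} = {[]}" by auto
  then show ?case by simp
next
  case (Suc d)
  let ?L = "{xs. set xs \<subseteq> S \<and> length xs = d}"
  have "(\<Sum>xs | set xs \<subseteq> S \<and> length xs = Suc d. prod_list (map f xs)) =
      (\<Sum>(x, xs)\<in>S \<times> ?L. f x * prod_list (map f xs))"
    by (rule sum.reindex_bij_witness[of _ "\<lambda>(x, xs). x # xs" "\<lambda>xs. (hd xs, tl xs)"])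
      (auto simp: length_Suc_conv)
  also have "\<dots> = (\<Sum>x\<in>S. f x) * (\<Sum>x\<in>S. f x) ^ d"
    by (simp add: Suc.IH[symmetric] sum_product sum.cartesian_product)
  finally show ?case by simp
qed

lemma prod_list_weight_power:
  fixes x y :: real
  shows "prod_list (map (\<lambda>t. f t * x ^ g t * y ^ h t) ts) =
    prod_list (map f ts) * x ^ sum_list (map g ts) * y ^ sum_list (map h ts)"
  by (induction ts) (simp_all add: power_add mult_ac)

context critical_weights
begin

text \<open>Up to rescaling by \<open>r\<close>, this is the probability generating function of the size of
  generation \<open>n\<close> in the branching process with offspring law \<open>w i * r ^ i / offspring D w r\<close>.\<close>

definition level_gf :: "nat \<Rightarrow> real \<Rightarrow> real" where
  "level_gf n x = (\<Sum>t\<in>low_trees D n. weight_below w n t * q ^ below n t * x ^ level n t)"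

lemma level_gf_0: "level_gf 0 x = x"
  by (simp add: level_gf_def low_trees_0 weight_below_0 below_0 level_0)

text \<open>The root contributes \<open>q\<close> and its weight, and the child subtrees vary
  independently.\<close>

lemma level_gf_Suc: "level_gf (Suc n) x = q * offspring D w (level_gf n x)"
proof -
  let ?L = "\<lambda>d. {ts. set ts \<subseteq> low_trees D n \<and> length ts = d}"
  let ?f = "\<lambda>t. weight_below w n t * q ^ below n t * x ^ level n t"
  have "weight_below w (Suc n) (Node ts) * q ^ below (Suc n) (Node ts) * x ^ level (Suc n) (Node ts) =
      w (length ts) * (q * prod_list (map ?f ts))" for ts
    by (simp only: prod_list_weight_power) (simp only: weight_below_Suc below_Suc level_Suc power_Suc mult_ac)
  then have "level_gf (Suc n) x =
    (\<Sum>ts\<in>(\<Union>d\<le>D. ?L d). w (length ts) * (q * prod_list (map ?f ts)))"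
    unfolding level_gf_def low_trees_Suc
    by (subst sum.reindex) (simp_all add: inj_on_def del: UN_simps)
  also have "\<dots> = (\<Sum>d\<le>D. \<Sum>ts\<in>?L d. w (length ts) * (q * prod_list (map ?f ts)))"
    by (rule sum.UNION_disjoint) (auto intro!: finite_lists_length_eq finite_low_trees)
  also have "\<dots> = (\<Sum>d\<le>D. w d * (q * (\<Sum>ts\<in>?L d. prod_list (map ?f ts))))"
    by (simp add: sum_distrib_left)
  also have "\<dots> = (\<Sum>d\<le>D. w d * (q * level_gf n x ^ d))"
    by (simp only: sum_lists_prod[OF finite_low_trees] level_gf_def)
  finally show ?thesis by (simp add: offspring_def sum_distrib_left mult_ac)
qed

text \<open>\<open>r\<close> is a fixed point of x \<mapsto> q \<phi>(x) by the definition of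
  \<open>q\<close>, with derivative q \<phi>'(r) = 1 by criticality; iteration keeps both.\<close>

lemma level_gf_critical: "level_gf n r = r \<and> (level_gf n has_real_derivative 1) (at r)"
proof (induction n)
  case 0
  have "level_gf 0 = (\<lambda>x. x)" by (simp add: level_gf_0 fun_eq_iff)
  then show ?case by simp
next
  case (Suc n)
  have "(offspring D w has_real_derivative (\<Sum>d\<le>D. w d * (real d * r ^ (d - 1)))) (at r)"
    unfolding offspring_def by (auto intro!: derivative_eq_intros simp: mult_ac)
  also have "(\<Sum>d\<le>D. w d * (real d * r ^ (d - 1))) = (\<Sum>d\<le>D. real d * w d * r ^ d) / r"
    unfolding sum_divide_distrib
  proof (intro sum.cong refl)
    fix d show "w d * (real d * r ^ (d - 1)) = real d * w d * r ^ d / r"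
      using r_pos by (cases d) simp_all
  qed
  also have "\<dots> = 1 / q" by (simp add: q_def critical[symmetric] offspring_def)
  finally have o: "(offspring D w has_real_derivative 1 / q) (at (level_gf n r))"
    using Suc by simp
  have "((\<lambda>x. q * offspring D w (level_gf n x)) has_real_derivative q * (1 / q * 1)) (at r)"
    by (intro DERIV_cmult DERIV_chain2[where f = "offspring D w" and g = "level_gf n", OF o] conjunct2[OF Suc])
  then show ?case
    using Suc q_pos r_pos offspring_pos[OF r_pos]
    by (simp add: level_gf_Suc[abs_def] q_def)
qed

text \<open>The sum is the derivative of \<open>level_gf n\<close> at \<open>r\<close>, taken term
  by term; trees with no vertex at height \<open>n\<close> contribute 0.\<close>

lemma total_mass:
  "(\<Sum>t\<in>plane_trees_height D n.
     weight_below w n t * q ^ below n t * (real (level n t) * r ^ (level n t - 1))) = 1"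
proof -
  have "(level_gf n has_real_derivative
     (\<Sum>t\<in>low_trees D n. weight_below w n t * q ^ below n t * (real (level n t) * r ^ (level n t - 1)))) (at r)"
    unfolding level_gf_def by (auto intro!: derivative_eq_intros simp: mult_ac)
  then have "(\<Sum>t\<in>low_trees D n. weight_below w n t * q ^ below n t * (real (level n t) * r ^ (level n t - 1))) = 1"
    using level_gf_critical DERIV_unique by blast
  also have "(\<Sum>t\<in>low_trees D n. weight_below w n t * q ^ below n t * (real (level n t) * r ^ (level n t - 1))) =
    (\<Sum>t\<in>plane_trees_height D n. weight_below w n t * q ^ below n t * (real (level n t) * r ^ (level n t - 1)))"
    by (rule sum.mono_neutral_right)
      (use finite_low_trees plane_trees_height_subset level_eq_0 in auto)
  finally show ?thesis by simp
qed

end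

section \<open>Total variation limits of discrete laws\<close>

lemma tv_dist_upper:
  "\<bar>measure_pmf.prob p A - measure_pmf.prob q A\<bar> \<le> tv_dist p q"
  unfolding tv_dist_def
proof (rule cSUP_upper)
  have "\<bar>measure_pmf.prob p A - measure_pmf.prob q A\<bar> \<le> 1" for A
    using measure_pmf.prob_le_1[of p A] measure_pmf.prob_le_1[of q A]
      measure_nonneg[of p A] measure_nonneg[of q A] by linarith
  then show "bdd_above (range (\<lambda>A. \<bar>measure_pmf.prob p A - measure_pmf.prob q A\<bar>))"
    by (intro bdd_aboveI[of _ 1]) auto
qed simp

text \<open>Convergence in total variation forces convergence of the point masses. Together with
  existence this resolves the definite description in \<open>P_lim\<close>.\<close>

lemma tv_limit_unique:
  assumes "tv_limit X P" "tv_limit X Q"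
  shows "P = Q"
proof (rule pmf_eqI)
  fix i
  have "(\<lambda>N. pmf (X N) i) \<longlonglongrightarrow> pmf R i" if "tv_limit X R" for R
  proof (rule LIM_zero_cancel, rule Lim_null_comparison)
    show "(\<lambda>N. tv_dist (X N) R) \<longlonglongrightarrow> 0" using that by (simp add: tv_limit_def)
    show "eventually (\<lambda>N. norm (pmf (X N) i - pmf R i) \<le> tv_dist (X N) R) sequentially"
      using tv_dist_upper[of _ "{i}" R] by (simp add: measure_pmf_single)
  qed
  then show "pmf P i = pmf Q i" using assms LIMSEQ_unique by blast
qed

text \<open>As the limit has total mass one, lower bounds on the point masses suffice: the deviation of
  an event from below controls, via its complement, the deviation from above.\<close>

lemma tv_limit_of_lower_bounds:
  assumes S: "finite S" "set_pmf Q \<subseteq> S"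
    and lower: "\<And>s c. s \<in> S \<Longrightarrow> c < pmf Q s \<Longrightarrow> eventually (\<lambda>N. pmf (X N) s \<ge> c) sequentially"
  shows "tv_limit X Q"
  unfolding tv_limit_def
proof (rule LIMSEQ_I)
  fix \<epsilon> :: real
  assume \<epsilon>: "\<epsilon> > 0"
  define \<delta> where "\<delta> = \<epsilon> / (2 * (real (card S) + 1))"
  have "\<epsilon> * real (card S) \<ge> 0" using \<epsilon> by simp
  then have \<delta>: "\<delta> > 0" "real (card S) * \<delta> < \<epsilon>"
    using \<epsilon> by (auto simp: \<delta>_def pos_divide_less_eq distrib_left mult.commute intro: add_nonneg_pos)
  have "eventually (\<lambda>N. \<forall>s\<in>S. pmf (X N) s \<ge> pmf Q s - \<delta>) sequentially"
    using \<delta> S by (intro eventually_ball_finite ballI lower) auto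
  then obtain M where M: "\<And>N s. N \<ge> M \<Longrightarrow> s \<in> S \<Longrightarrow> pmf (X N) s \<ge> pmf Q s - \<delta>"
    by (auto simp: eventually_sequentially)
  have "norm (tv_dist (X N) Q - 0) < \<epsilon>" if N: "N \<ge> M" for N
  proof -
    have below: "measure_pmf.prob Q A - measure_pmf.prob (X N) A \<le> real (card S) * \<delta>" for A
    proof -
      have fin: "finite (A \<inter> S)" using S by simp
      have "measure_pmf.prob Q A = measure_pmf.prob Q (A \<inter> S)"
        using S by (intro measure_eq_AE) (auto simp: AE_measure_pmf_iff)
      moreover have "measure_pmf.prob (X N) A \<ge> measure_pmf.prob (X N) (A \<inter> S)"
        by (intro measure_pmf.finite_measure_mono) auto
      ultimately have "measure_pmf.prob Q A - measure_pmf.prob (X N) A \<le>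
          (\<Sum>s\<in>A \<inter> S. pmf Q s - pmf (X N) s)"
        by (simp add: measure_measure_pmf_finite[OF fin] sum_subtractf)
      also have "\<dots> \<le> (\<Sum>s\<in>A \<inter> S. \<delta>)"
      proof (rule sum_mono)
        fix s assume "s \<in> A \<inter> S"
        then show "pmf Q s - pmf (X N) s \<le> \<delta>" using M[OF N, of s] by simp
      qed
      also have "\<dots> \<le> real (card S) * \<delta>"
        using S \<delta> by (simp add: card_mono mult_right_mono)
      finally show ?thesis .
    qed
    have "\<bar>measure_pmf.prob (X N) A - measure_pmf.prob Q A\<bar> \<le> real (card S) * \<delta>" for A
      using below[of A] below[of "- A"]
      by (simp add: abs_le_iff measure_pmf.prob_compl[of A, simplified] Compl_eq_Diff_UNIV)
    then have "tv_dist (X N) Q \<le> real (card S) * \<delta>"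
      unfolding tv_dist_def by (intro cSUP_least) auto
    moreover have "tv_dist (X N) Q \<ge> 0"
      using tv_dist_upper[of "X N" "{}" Q] by simp
    ultimately show ?thesis using \<delta> by simp
  qed
  then show "\<exists>no. \<forall>N\<ge>no. norm (tv_dist (X N) Q - 0) < \<epsilon>" by blast
qed

lemma pmf_of_finite_mass:
  assumes "finite S" "\<And>s. s \<in> S \<Longrightarrow> f s \<ge> 0" "(\<Sum>s\<in>S. f s) = 1"
  obtains Q where "\<And>s. s \<in> S \<Longrightarrow> pmf Q s = f s" "set_pmf Q \<subseteq> S"
proof -
  let ?f = "\<lambda>s. if s \<in> S then f s else 0"
  have "(\<integral>\<^sup>+s. ennreal (?f s) \<partial>count_space UNIV) = (\<Sum>s\<in>S. ennreal (?f s))"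
    by (rule nn_integral_count_space'[OF assms(1)]) auto
  also have "\<dots> = ennreal (\<Sum>s\<in>S. ?f s)"
    using assms by (intro sum_ennreal) auto
  finally have pmf: "pmf (embed_pmf ?f) s = ?f s" for s
    using assms by (subst pmf_embed_pmf) auto
  moreover have "set_pmf (embed_pmf ?f) \<subseteq> S"
    by (auto simp: set_pmf_eq pmf split: if_splits)
  ultimately show ?thesis using that[of "embed_pmf ?f"] by simp
qed

section \<open>The limit law\<close>

text \<open>Each of two distinct critical points would be the strict maximiser of s /
  \<phi>(s).\<close>

lemma critical_weights_unique:
  assumes "critical_weights D w r" "critical_weights D w s"
  shows "r = s"
proof (rule ccontr)
  assume "r \<noteq> s"
  interpret r: critical_weights D w r by (rule assms)
  interpret s: critical_weights D w s by (rule assms)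
  have "s.q < r.q" "r.q < s.q"
    using r.less_q[OF s.r_pos] s.less_q[OF r.r_pos] \<open>r \<noteq> s\<close> by (simp_all add: r.q_def s.q_def)
  then show False by simp
qed

text \<open>Intermediate value theorem for h(x) = x \<phi>'(x) - \<phi>(x), which is negative at 0;
  for large x the term i = 2 outweighs i = 0, the only negative one.\<close>

lemma critical_weights_exists:
  assumes D: "D \<ge> 2" and w: "\<And>i. i \<le> D \<Longrightarrow> w i > 0" "\<And>i. i > D \<Longrightarrow> w i = 0"
  obtains r where "critical_weights D w r"
proof -
  let ?h = "\<lambda>x :: real. \<Sum>i\<le>D. (real i - 1) * w i * x ^ i"
  have w0: "w 0 > 0" and w2: "w 2 > 0" using D w by auto
  \<comment> \<open>Chosen so that \<open>R \<ge> 1\<close> and \<open>w 2 * R \<ge> w 0\<close>,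
    hence also \<open>w 2 * R ^ 2 \<ge> w 0\<close>.\<close>
  define R where "R = 1 + w 0 / w 2"
  have R: "R \<ge> 1" using w0 w2 by (simp add: R_def)
  have "?h 0 = (\<Sum>i\<le>D. if i = 0 then - w 0 else 0)"
    by (intro sum.cong) auto
  then have h0: "?h 0 = - w 0" by simp
  have "w 0 \<le> w 2 * R" using w0 w2 by (simp add: R_def distrib_left)
  also have "\<dots> \<le> w 2 * R ^ 2" using R w2 by (simp add: self_le_power)
  finally have "0 \<le> (\<Sum>i\<in>{0, 2}. (real i - 1) * w i * R ^ i)" by simp
  also have "\<dots> \<le> ?h R"
  proof (rule sum_mono2)
    fix i assume "i \<in> {..D} - {0, 2}"
    then show "0 \<le> (real i - 1) * w i * R ^ i"
      using w(1)[of i] R by (intro mult_nonneg_nonneg) (auto simp: less_imp_le)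
  qed (use D in auto)
  finally have "0 \<le> ?h R" .
  then have "\<exists>x. 0 \<le> x \<and> x \<le> R \<and> ?h x = 0"
    using h0 w0 R by (intro IVT) (auto intro!: continuous_intros)
  then obtain x where x: "0 \<le> x" "?h x = 0" by blast
  then have "x \<noteq> 0" using h0 w0 by auto
  with x have "critical_weights D w x"
    using D w by unfold_locales (auto simp: left_diff_distrib sum_subtractf)
  then show ?thesis by (rule that)
qed

section \<open>The minimiser of \<open>J\<close>\<close>

lemma xlnx_ge:
  assumes x: "(x :: real) \<ge> 0" and y: "y > 0"
  shows "x * ln x - x * ln y - (x - y) \<ge> 0"
    and "x * ln x - x * ln y - (x - y) = 0 \<longleftrightarrow> x = y"
proof -
  have *: "x * ln x - x * ln y - (x - y) \<ge> 0 \<and> (x * ln x - x * ln y - (x - y) = 0 \<longleftrightarrow> x = y)"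
  proof (cases "x = 0")
    case True
    then show ?thesis using y by simp
  next
    case False
    then have x: "x > 0" using assms by simp
    \<comment> \<open>Reduces the claim to ln u \<le> u - 1 at u = y / x, with equality only for u =
      1.\<close>
    have eq: "x * ln x - x * ln y - (x - y) = x * ((y / x - 1) - ln (y / x))"
      using x y by (simp add: ln_div field_simps)
    have "ln (y / x) \<le> y / x - 1" using x y by (intro ln_le_minus_one) simp
    moreover have "ln (y / x) = y / x - 1 \<longleftrightarrow> x = y"
      using ln_eq_minus_one[of "y / x"] x y by auto
    ultimately show ?thesis unfolding eq using x by auto
  qed
  then show "x * ln x - x * ln y - (x - y) \<ge> 0"
    "x * ln x - x * ln y - (x - y) = 0 \<longleftrightarrow> x = y" by auto
qed

text \<open>Cutting off beyond \<open>D\<close> encodes the degree bound: trees with a larger degree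
  get weight 0.\<close>

definition boltzmann :: "nat \<Rightarrow> (nat \<Rightarrow> real) \<Rightarrow> real \<Rightarrow> nat \<Rightarrow> real" where
  "boltzmann D E \<beta> i = (if i \<le> D then exp (- \<beta> * E i) else 0)"

text \<open>Existence and uniqueness of the critical point resolve the definite description in
  \<open>\<rho>\<close>.\<close>

lemma boltzmann_critical:
  assumes "D \<ge> 2"
  shows "critical_weights D (boltzmann D E \<beta>) (\<rho> D E \<beta>)"
proof -
  obtain r where r: "critical_weights D (boltzmann D E \<beta>) r"
    by (rule critical_weights_exists[OF assms, of "boltzmann D E \<beta>"]) (auto simp: boltzmann_def)
  have iff: "critical_weights D (boltzmann D E \<beta>) s \<longleftrightarrow> s > 0 \<and>
    (\<Sum>i\<le>D. exp (- \<beta> * E i) * s ^ i) = (\<Sum>i\<le>D. real i * exp (- \<beta> * E i) * s ^ i)" for s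
    using assms by (auto simp: critical_weights_def boltzmann_def)
  have "\<rho> D E \<beta> = r"
    unfolding \<rho>_def iff[symmetric] using r critical_weights_unique by blast
  then show ?thesis using r by simp
qed

lemma C_eq: "C D E \<beta> = 1 / offspring D (boltzmann D E \<beta>) (\<rho> D E \<beta>)"
  by (simp add: C_def offspring_def boltzmann_def)

text \<open>Gibbs variational principle. The logarithm of p i = C w i \<rho>^i is affine in E i and
  i, and the sums of x i and of i x i are fixed on \<Delta>; hence J(x) is ln q plus the relative
  entropy of x with respect to p, and p is the only minimiser.\<close>

lemma \<sigma>_eq:
  assumes D: "D \<ge> 2"
  shows "\<sigma> D E \<beta> = C D E \<beta> * \<rho> D E \<beta>"
proof -
  define r where "r = \<rho> D E \<beta>"
  define w where "w = boltzmann D E \<beta>"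
  interpret critical_weights D w r
    unfolding w_def r_def by (rule boltzmann_critical[OF D])
  define \<phi> where "\<phi> = offspring D w r"
  have \<phi>: "\<phi> > 0" by (simp add: \<phi>_def offspring_pos r_pos)
  \<comment> \<open>Restricted to \<open>{..D}\<close> because \<open>\<Delta>\<close> consists of
    extensional functions.\<close>
  define p where "p = (\<lambda>i\<in>{..D}. w i * r ^ i / \<phi>)"
  have p_eq: "p i = w i * r ^ i / \<phi>" if "i \<le> D" for i using that by (simp add: p_def)
  have p_ext: "p \<in> extensional {..D}" by (simp add: p_def)
  have p_pos: "p i > 0" if "i \<le> D" for i using that \<phi> w_pos r_pos by (simp add: p_eq)
  have sum_p: "(\<Sum>i\<le>D. p i) = 1"
    using \<phi> by (simp add: p_eq sum_divide_distrib[symmetric]) (simp add: \<phi>_def offspring_def)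
  have sum_ip: "(\<Sum>i\<le>D. real i * p i) = 1"
    using \<phi> critical
    by (simp add: p_eq sum_divide_distrib[symmetric] mult.assoc) (simp add: \<phi>_def offspring_def)
  have "p i \<le> 1" if "i \<le> D" for i
    using member_le_sum[of i "{..D}" p] that p_pos sum_p by (simp add: less_imp_le)
  then have "p \<in> {..D} \<rightarrow>\<^sub>E {0..1}"
    using p_pos by (auto simp: PiE_iff less_imp_le p_ext)
  then have p_mem: "p \<in> \<Delta> D"
    using sum_p sum_ip by (simp add: \<Delta>_def)
  \<comment> \<open>The corrections x i - p i sum to 0 but make every single summand nonnegative, by
    \<open>xlnx_ge\<close>.\<close>
  have gibbs: "J D E \<beta> x = ln q + (\<Sum>i\<le>D. x i * ln (x i) - x i * ln (p i) - (x i - p i))"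
    if x: "x \<in> \<Delta> D" for x
  proof -
    have sx: "(\<Sum>i\<le>D. x i) = 1" "(\<Sum>i\<le>D. real i * x i) = 1" using x by (auto simp: \<Delta>_def)
    have "(\<Sum>i\<le>D. x i * ln (p i)) = (\<Sum>i\<le>D. - \<beta> * (x i * E i) + ln r * (real i * x i) - ln \<phi> * x i)"
    proof (intro sum.cong refl)
      fix i assume "i \<in> {..D}"
      then have "ln (p i) = - \<beta> * E i + real i * ln r - ln \<phi>"
        using \<phi> r_pos by (simp add: p_eq w_def boltzmann_def ln_div ln_mult ln_realpow)
      then show "x i * ln (p i) = - \<beta> * (x i * E i) + ln r * (real i * x i) - ln \<phi> * x i"
        by (simp only:) (simp add: algebra_simps)
    qed
    also have "\<dots> = - \<beta> * (\<Sum>i\<le>D. x i * E i) + ln r - ln \<phi>"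
      by (simp only: sum_subtractf sum.distrib sum_distrib_left[symmetric] sx mult_1_right)
    also have "\<dots> = - \<beta> * (\<Sum>i\<le>D. x i * E i) + ln q"
      using \<phi> r_pos by (simp add: q_def \<phi>_def[symmetric] ln_div)
    finally show ?thesis
      using sum_p sx by (simp add: J_def sum_subtractf)
  qed
  have ge: "x i * ln (x i) - x i * ln (p i) - (x i - p i) \<ge> 0" if "x \<in> \<Delta> D" "i \<in> {..D}" for x i
    using that by (intro xlnx_ge p_pos) (auto simp: \<Delta>_def)
  have ge_sum: "(\<Sum>i\<le>D. x i * ln (x i) - x i * ln (p i) - (x i - p i)) \<ge> 0" if "x \<in> \<Delta> D" for x
    using that by (intro sum_nonneg ge)
  have Jp: "J D E \<beta> p = ln q" using gibbs[OF p_mem] by simp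
  have "p_star D E \<beta> = p"
    unfolding p_star_def
  proof (rule the_equality)
    show "is_arg_min (J D E \<beta>) (\<lambda>p. p \<in> \<Delta> D) p"
    proof -
      have "\<not> J D E \<beta> x < ln q" if "x \<in> \<Delta> D" for x
        using gibbs[OF that] ge_sum[OF that] by linarith
      then show ?thesis unfolding is_arg_min_def Jp using p_mem by blast
    qed
    fix x assume "is_arg_min (J D E \<beta>) (\<lambda>p. p \<in> \<Delta> D) x"
    then have x: "x \<in> \<Delta> D" "J D E \<beta> x \<le> ln q"
      using p_mem Jp by (auto simp: is_arg_min_def not_less)
    then have "(\<Sum>i\<le>D. x i * ln (x i) - x i * ln (p i) - (x i - p i)) = 0"
      using gibbs[OF x(1)] ge_sum[OF x(1)] x(2) by linarith
    then have "\<forall>i\<in>{..D}. x i * ln (x i) - x i * ln (p i) - (x i - p i) = 0"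
      by (subst (asm) sum_nonneg_eq_0_iff) (use ge[OF x(1)] in auto)
    then have "x i = p i" if "i \<in> {..D}" for i
      using xlnx_ge(2)[of "x i" "p i"] x(1) p_pos[of i] that by (auto simp: \<Delta>_def PiE_iff)
    then show "x = p"
      using x(1) p_mem by (intro PiE_ext[of x "{..D}" "\<lambda>_. {0..1}" p]) (auto simp: \<Delta>_def)
  qed
  then show ?thesis
    using q_pos Jp unfolding \<sigma>_def C_eq w_def[symmetric] r_def[symmetric] by (simp add: q_def)
qed

section \<open>Translation to the measures \<open>mu\<close>\<close>

lemma weight_boltzmann:
  "weight (boltzmann D E \<beta>) t =
    (if \<forall>v\<in>verts t. deg t v \<le> D then exp (- \<beta> * energy E t) else 0)"
proof (cases "\<forall>v\<in>verts t. deg t v \<le> D")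
  case True
  then have "weight (boltzmann D E \<beta>) t = (\<Prod>v\<in>verts t. exp (- \<beta> * E (deg t v)))"
    by (simp add: weight_def boltzmann_def)
  also have "\<dots> = exp (- \<beta> * energy E t)"
    by (simp add: exp_sum[OF finite_verts, symmetric] energy_def sum_distrib_left)
  finally show ?thesis using True by simp
next
  case False
  then have "weight (boltzmann D E \<beta>) t = 0"
    unfolding weight_def by (intro prod_zero finite_verts) (auto simp: boltzmann_def)
  then show ?thesis using False by simp
qed

lemma weight_below_boltzmann:
  assumes "\<forall>v\<in>verts t. deg t v \<le> D"
  shows "weight_below (boltzmann D E \<beta>) n t = exp (- \<beta> * energy_below E n t)"
proof -
  have "weight_below (boltzmann D E \<beta>) n t = (\<Prod>v\<in>{v \<in> verts t. length v < n}. exp (- \<beta> * E (deg t v)))"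
    unfolding weight_below_def using assms by (intro prod.cong) (auto simp: boltzmann_def)
  then show ?thesis
    by (simp add: exp_sum finite_verts energy_below_def sum_distrib_left)
qed

lemma tgf_boltzmann:
  "fps_nth (tgf (weight (boltzmann D E \<beta>)) S) N = (\<Sum>t\<in>plane_trees D N \<inter> S. exp (- \<beta> * energy E t))"
proof -
  have "fps_nth (tgf (weight (boltzmann D E \<beta>)) S) N = (\<Sum>t\<in>plane_trees D N \<inter> S. weight (boltzmann D E \<beta>) t)"
    unfolding tgf_def fps_nth_Abs_fps
    by (rule sum.mono_neutral_right)
      (auto simp: finite_tsize plane_trees_def tsize_def[symmetric] weight_boltzmann)
  also have "\<dots> = (\<Sum>t\<in>plane_trees D N \<inter> S. exp (- \<beta> * energy E t))"
    by (intro sum.cong) (auto simp: weight_boltzmann plane_trees_def)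
  finally show ?thesis .
qed

lemma pmf_trunc_mu:
  assumes "D \<ge> 1" "N \<ge> 1"
  shows "pmf (map_pmf (trunc n) (mu D E \<beta> N)) s =
    fps_nth (tgf (weight (boltzmann D E \<beta>)) {t. trunc n t = s}) N /
    fps_nth (tgf (weight (boltzmann D E \<beta>)) UNIV) N"
proof -
  let ?S = "{t. trunc n t = s}"
  have fin: "finite (plane_trees D N \<inter> ?S)" using finite_plane_trees by blast
  have "pmf (map_pmf (trunc n) (mu D E \<beta> N)) s = measure_pmf.prob (mu D E \<beta> N) ?S"
    by (simp add: pmf_map vimage_def)
  also have "\<dots> = measure_pmf.prob (mu D E \<beta> N) (plane_trees D N \<inter> ?S)"
    by (rule measure_pmf.finite_measure_eq_AE)
      (auto simp: AE_measure_pmf_iff set_pmf_eq pmf_mu[OF assms] split: if_splits)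
  also have "\<dots> = (\<Sum>t\<in>plane_trees D N \<inter> ?S. exp (- \<beta> * energy E t) / Z D E \<beta> N)"
    unfolding measure_measure_pmf_finite[OF fin] pmf_mu[OF assms] by (intro sum.cong) auto
  finally show ?thesis
    by (simp add: tgf_boltzmann Z_def sum_divide_distrib)
qed

theorem theorem4:
  fixes D n :: nat and E :: "nat \<Rightarrow> real" and \<beta> :: real
  assumes "D \<ge> 2" and "n \<ge> 1"
  shows "tv_limit (\<lambda>N. map_pmf (trunc n) (mu D E \<beta> N)) (P_lim D E \<beta> n) \<and>
    set_pmf (P_lim D E \<beta> n) \<subseteq> plane_trees_height D n \<and>
    (\<forall>\<tau>\<in>plane_trees_height D n.
      let k = card {v\<in>verts \<tau>. length v = n}; m = card {v\<in>verts \<tau>. length v < n}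
      in pmf (P_lim D E \<beta> n) \<tau> =
        C D E \<beta> * real k * exp (- \<beta> * energy_below E n \<tau>) * \<rho> D E \<beta> ^ k * \<sigma> D E \<beta> ^ (m - 1))"
proof -
  define r where "r = \<rho> D E \<beta>"
  define w where "w = boltzmann D E \<beta>"
  interpret critical_weights D w r
    unfolding w_def r_def by (rule boltzmann_critical[OF assms(1)])
  let ?S = "plane_trees_height D n" and ?X = "\<lambda>N. map_pmf (trunc n) (mu D E \<beta> N)"
  let ?f = "\<lambda>s. weight_below w n s * q ^ below n s * (real (level n s) * r ^ (level n s - 1))"
  have fin: "finite ?S"
    using plane_trees_height_subset finite_low_trees by (rule finite_subset)
  have "?f s \<ge> 0" for s
    using q_pos r_pos by (simp add: weight_below_def prod_nonneg w_nonneg)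
  then obtain Q where Q: "\<And>s. s \<in> ?S \<Longrightarrow> pmf Q s = ?f s" "set_pmf Q \<subseteq> ?S"
    using pmf_of_finite_mass[OF fin _ total_mass] by metis
  have lim: "tv_limit ?X Q"
  proof (rule tv_limit_of_lower_bounds[OF fin Q(2)])
    fix s c
    assume s: "s \<in> ?S" and c: "c < pmf Q s"
    have "s \<in> low_trees D n" using s plane_trees_height_subset by blast
    then have "eventually (\<lambda>N. fps_nth (tgf (weight w) {t. trunc n t = s}) N / a N \<ge> c) sequentially"
      using c Q(1)[OF s] by (intro fibre_lower) (auto simp: low_trees_def)
    then show "eventually (\<lambda>N. pmf (?X N) s \<ge> c) sequentially"
      using eventually_ge_at_top[of 1]
      by eventually_elim (use assms(1) in \<open>simp add: pmf_trunc_mu w_def[symmetric] gf_def\<close>)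
  qed
  have P: "P_lim D E \<beta> n = Q"
    unfolding P_lim_def using lim tv_limit_unique by blast
  have "?f s = C D E \<beta> * real (level n s) * exp (- \<beta> * energy_below E n s) * r ^ level n s *
      \<sigma> D E \<beta> ^ (below n s - 1)" if s: "s \<in> ?S" for s
  proof -
    \<comment> \<open>As n \<ge> 1 the root lies below height \<open>n\<close>, so
      \<open>below n s - 1\<close> is a true subtraction.\<close>
    have "[] \<in> {v \<in> verts s. length v < n}" using assms(2) by (simp add: verts_def)
    then have "below n s \<noteq> 0" by (auto simp: below_def finite_verts)
    then obtain m where m: "below n s = Suc m" by (cases "below n s") auto
    have q: "q = C D E \<beta> * r" unfolding q_def by (simp add: C_eq w_def r_def)
    have "\<sigma> D E \<beta> = q" by (simp only: \<sigma>_eq[OF assms(1)] q r_def[symmetric])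
    moreover have "weight_below w n s = exp (- \<beta> * energy_below E n s)"
      unfolding w_def using s by (intro weight_below_boltzmann) (simp add: plane_trees_height_def)
    \<comment> \<open>One of the \<open>below n s\<close> factors q = C r supplies the constant C
      and raises r^(k-1) to r^k, where k = \<open>level n s\<close>.\<close>
    moreover have "q ^ below n s * (real (level n s) * r ^ (level n s - 1)) =
        C D E \<beta> * real (level n s) * r ^ level n s * q ^ m"
      by (cases "level n s") (simp_all add: m q)
    ultimately show ?thesis by (simp add: m mult_ac)
  qed
  then show ?thesis
    using lim Q unfolding P by (auto simp: Let_def level_def below_def r_def)
qed

end
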